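(* Let $N\ge 2$ and $q\ge 2$ be integers, $b=qN$, $\mathcal D=\{0,1,\ldots,N-1\}$ and $\mathcal C=(-\frac N2,\frac N2]\cap\mathbb Z$. Let $t$ be a positive integer with $\gcd(t,N)=1$. Then $t$ is a complete number of the spectral pair $(\mu_{b,q\mathcal D},\Lambda(b,\mathcal C))$ if and only if $\frac{t}{\gcd(t,b)}$ is a complete number of this pair.
   Context: For a finite set $B\subset\mathbb R$ and $\rho>1$, $\mu_{\rho,B}$ is the unique Borel probability measure on $\mathbb R$ with $\mu_{\rho,B}(\cdot)=\frac1{\#B}\sum_{a\in B}\mu_{\rho,B}\circ\phi_a^{-1}(\cdot)$, where $\phi_a(x)=\rho^{-1}(x+a)$. Put $q\mathcal D=\{qd:d\in\mathcal D\}$ and $\Lambda(b,\mathcal C)=\{\sum_{k=0}^n b^kc_k: n\ge 0,\ c_k\in\mathcal C\}$. A pair $(\mu,\Lambda)$ of a compactly supported Borel probability measure on $\mathbb R$ and a countable set $\Lambda\subset\mathbb R$ is a spectral pair if $\{e^{-2\pi i\lambda x}:\lambda\in\Lambda\}$ is an orthonormal basis of $L^2(\mu)$. It is known that $(\mu_{b,q\mathcal D},\Lambda(b,\mathcal C))$ is a spectral pair. A real number $t$ is a complete number (of this pair) if $(\mu_{b,q\mathcal D},t\Lambda(b,\mathcal C))$ is also a spectral pair, and an incomplete number otherwise. *)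

theory Defs
  imports "HOL-Probability.Probability"
begin

section \<open>Orthonormal bases of \<open>L\<^sup>2(M)\<close>\<close>

text \<open>Elements of \<open>L\<^sup>2(M)\<close> are represented by square-integrable functions; no quotient by
  almost-everywhere equality is taken, since all notions below are invariant under it.\<close>

definition L2_space :: "'a measure \<Rightarrow> ('a \<Rightarrow> complex) set" where
  "L2_space M = {f \<in> borel_measurable M. integrable M (\<lambda>x. (norm (f x))\<^sup>2)}"

definition L2_inner :: "'a measure \<Rightarrow> ('a \<Rightarrow> complex) \<Rightarrow> ('a \<Rightarrow> complex) \<Rightarrow> complex" where
  "L2_inner M f g = (LINT x|M. f x * cnj (g x))"

definition L2_norm :: "'a measure \<Rightarrow> ('a \<Rightarrow> complex) \<Rightarrow> real" where
  "L2_norm M f = sqrt (LINT x|M. (norm (f x))\<^sup>2)"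

text \<open>A family is an orthonormal basis if it is orthonormal and its finite linear span is dense.
  Orthonormality is that of the indexed family, so distinct indices give orthogonal elements.\<close>

definition L2_orthonormal_basis :: "'a measure \<Rightarrow> 'i set \<Rightarrow> ('i \<Rightarrow> 'a \<Rightarrow> complex) \<Rightarrow> bool" where
  "L2_orthonormal_basis M I e \<longleftrightarrow>
     (\<forall>i\<in>I. e i \<in> L2_space M) \<and>
     (\<forall>i\<in>I. \<forall>j\<in>I. L2_inner M (e i) (e j) = (if i = j then 1 else 0)) \<and>
     (\<forall>f\<in>L2_space M. \<forall>\<epsilon>>0. \<exists>F c. finite F \<and> F \<subseteq> I \<and>
        L2_norm M (\<lambda>x. f x - (\<Sum>i\<in>F. c i * e i x)) < \<epsilon>)"


section \<open>Spectral pairs and complete numbers\<close>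

definition spectral_pair :: "real measure \<Rightarrow> real set \<Rightarrow> bool" where
  "spectral_pair \<mu> \<Lambda> \<longleftrightarrow>
     prob_space \<mu> \<and> sets \<mu> = sets borel \<and>
     (\<exists>K. compact K \<and> emeasure \<mu> (- K) = 0) \<and>
     countable \<Lambda> \<and>
     L2_orthonormal_basis \<mu> \<Lambda> (\<lambda>l x. exp (- 2 * complex_of_real pi * \<i> * complex_of_real (l * x)))"

definition complete_number :: "real measure \<Rightarrow> real set \<Rightarrow> real \<Rightarrow> bool" where
  "complete_number \<mu> \<Lambda> t \<longleftrightarrow> spectral_pair \<mu> ((\<lambda>l. t * l) ` \<Lambda>)"


section \<open>Self-similar measures and the associated frequency sets\<close>

definition self_similar :: "real \<Rightarrow> real set \<Rightarrow> real measure \<Rightarrow> bool" where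
  "self_similar \<rho> B \<mu> \<longleftrightarrow>
     prob_space \<mu> \<and> sets \<mu> = sets borel \<and>
     (\<forall>A\<in>sets borel. measure \<mu> A =
        (1 / real (card B)) * (\<Sum>a\<in>B. measure \<mu> ((\<lambda>x. inverse \<rho> * (x + a)) -` A)))"

text \<open>Existence and uniqueness, which give this description its meaning, are Hutchinson's theorem
  for finite nonempty \<open>B\<close> and \<open>\<rho> > 1\<close>; outside this range the value is unspecified.\<close>

definition self_similar_measure :: "real \<Rightarrow> real set \<Rightarrow> real measure" where
  "self_similar_measure \<rho> B = (THE \<mu>. self_similar \<rho> B \<mu>)"

definition Lambda_set :: "real \<Rightarrow> real set \<Rightarrow> real set" where
  "Lambda_set b C = {(\<Sum>k\<le>n. b ^ k * c k) | (n::nat) c. \<forall>k\<le>n. c k \<in> C}"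

end

theory Submission
  imports Defs
begin

text \<open>
  Write \<open>e\<^sub>\<lambda>(x) = exp(-2\<pi>i\<lambda>x)\<close> and let \<open>Q(\<xi>)\<close> be the squared norm of the orthogonal projection of \<open>e\<^sub>\<xi>\<close> to
  the closed span of the exponentials with frequencies in \<open>t\<Lambda>\<close>, which are always orthonormal when
  \<open>t\<close> is coprime to \<open>N\<close>. Since \<open>\<Lambda> = C + b\<Lambda>\<close>, the continuous function \<open>Q\<close> is harmonic for the random
  walk that moves from \<open>\<xi>\<close> to \<open>(\<xi> - t c) / b\<close> with probability \<open>|M((\<xi> - t c) / N)|\<^sup>2\<close>, where \<open>M\<close> is the
  mean of \<open>N\<close> characters and vanishes only at points of \<open>\<int> / N\<close>. By the minimum principle, \<open>Q\<close> is identically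
  \<open>1\<close> (and then all exponentials, hence all of \<open>L\<^sup>2\<close>, lie in the span) unless there is a nonempty
  set \<open>E\<close> of nonzero integers such that every \<open>x \<in> E\<close> is \<open>t c + b y\<close> with \<open>c \<in> C\<close>, \<open>y \<in> E\<close>; conversely,
  \<open>e\<^sub>x\<close> is orthogonal to the whole system for \<open>x\<close> in such a set. Finally, the elements of
  such a set are divisible by \<open>g = gcd t b\<close>, so multiplication by \<open>g\<close> is a bijection between the sets for
  \<open>t / g\<close> and those for \<open>t\<close>.
\<close>

section \<open>Self-similar measures\<close>

text \<open>The equation on sets says that \<open>\<mu>\<close> is the image of the product of the
  uniform measure on \<open>B\<close> with \<open>\<mu>\<close> under the map taking
  \<open>(a, x)\<close> to \<open>(x + a) / \<rho>\<close>. Fubini then splits the integral,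
  boundedness of \<open>f\<close> giving integrability.\<close>

lemma self_similar_integral:
  fixes f :: "real \<Rightarrow> complex"
  assumes ss: "self_similar \<rho> B \<mu>" and B: "finite B" "B \<noteq> {}"
    and f: "f \<in> borel_measurable borel" and bound: "\<And>x. norm (f x) \<le> K"
  shows "(LINT x|\<mu>. f x) = (\<Sum>a\<in>B. LINT x|\<mu>. f (inverse \<rho> * (x + a))) / of_nat (card B)"
proof -
  define U where "U = uniform_count_measure B"
  have [measurable_cong]: "sets U = sets (count_space B)"
    by (simp add: U_def sets_uniform_count_measure_count_space)
  have s\<mu>[measurable_cong]: "sets \<mu> = sets borel" and "prob_space \<mu>"
    using ss by (auto simp: self_similar_def)
  interpret \<mu>: prob_space \<mu> by fact
  interpret U: prob_space U
    using B unfolding U_def by (rule prob_space_uniform_count_measure)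
  interpret P: pair_prob_space U \<mu> ..
  note f[measurable]
  have sp: "space \<mu> = UNIV" using s\<mu> by (metis sets_eq_imp_space_eq space_borel)
  have id: "(\<lambda>a::real. a) \<in> U \<rightarrow>\<^sub>M borel"
    by (subst measurable_cong_sets[of U "count_space B" borel borel])
       (simp_all add: U_def sets_uniform_count_measure_count_space)
  have \<phi>[measurable]: "(\<lambda>p. inverse \<rho> * (snd p + fst p)) \<in> U \<Otimes>\<^sub>M \<mu> \<rightarrow>\<^sub>M borel"
    using measurable_compose[OF measurable_fst id] by measurable
  have eq: "\<mu> = distr (U \<Otimes>\<^sub>M \<mu>) borel (\<lambda>p. inverse \<rho> * (snd p + fst p))"
  proof (rule measure_eqI)
    fix A assume "A \<in> sets \<mu>"
    then have A[measurable]: "A \<in> sets borel" by (simp add: s\<mu>)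
    have m: "(\<lambda>x. inverse \<rho> * (x + a)) -` A \<in> sets \<mu>" for a
      using measurable_sets[of "\<lambda>x. inverse \<rho> * (x + a)" borel borel A] by (simp add: s\<mu>)
    have "emeasure (distr (U \<Otimes>\<^sub>M \<mu>) borel (\<lambda>p. inverse \<rho> * (snd p + fst p))) A
        = (\<integral>\<^sup>+ a. emeasure \<mu> ((\<lambda>x. inverse \<rho> * (x + a)) -` A) \<partial>U)"
      by (subst emeasure_distr[OF \<phi> A], subst \<mu>.emeasure_pair_measure_alt)
         (auto intro!: nn_integral_cong arg_cong[where f="emeasure \<mu>"]
           simp: space_pair_measure sp)
    also have "\<dots> = (\<Sum>a\<in>B. ennreal (1 / card B) * emeasure \<mu> ((\<lambda>x. inverse \<rho> * (x + a)) -` A))"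
      unfolding U_def uniform_count_measure_def using B
      by (simp add: nn_integral_point_measure_finite)
    also have "\<dots> = ennreal (\<Sum>a\<in>B. (1 / card B) * measure \<mu> ((\<lambda>x. inverse \<rho> * (x + a)) -` A))"
      by (simp add: \<mu>.emeasure_eq_measure sum_ennreal flip: ennreal_mult')
    also have "\<dots> = emeasure \<mu> A"
      using ss A by (simp add: \<mu>.emeasure_eq_measure self_similar_def sum_distrib_left)
    finally show "emeasure \<mu> A
      = emeasure (distr (U \<Otimes>\<^sub>M \<mu>) borel (\<lambda>p. inverse \<rho> * (snd p + fst p))) A" by simp
  qed (simp add: s\<mu>)
  have "(LINT x|\<mu>. f x) = (LINT p|(U \<Otimes>\<^sub>M \<mu>). f (inverse \<rho> * (snd p + fst p)))"
    by (subst eq, subst integral_distr) auto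
  also have "\<dots> = (LINT a|U. LINT x|\<mu>. f (inverse \<rho> * (x + a)))"
    by (subst P.integral_fst'[symmetric])
       (auto intro!: P.integrable_const_bound[where B=K] bound)
  also have "\<dots> = (\<Sum>a\<in>B. LINT x|\<mu>. f (inverse \<rho> * (x + a))) / of_nat (card B)"
    unfolding U_def uniform_count_measure_def using B
    by (simp add: lebesgue_integral_point_measure_finite scaleR_conv_of_real
        sum_divide_distrib)
  finally show ?thesis .
qed

lemma self_similar_real_distribution: "self_similar \<rho> B \<mu> \<Longrightarrow> real_distribution \<mu>"
  by (auto simp: self_similar_def real_distribution_def real_distribution_axioms_def)

section \<open>Characteristic functions; uniqueness and existence of the self-similar
  measure\<close>

lemma self_similar_char:
  assumes ss: "self_similar \<rho> B \<mu>" and B: "finite B" "B \<noteq> {}"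
  shows "char \<mu> s = (\<Sum>a\<in>B. iexp (s * (inverse \<rho> * a))) / of_nat (card B) * char \<mu> (s * inverse \<rho>)"
proof -
  have "char \<mu> s = (\<Sum>a\<in>B. LINT x|\<mu>. iexp (s * (inverse \<rho> * (x + a)))) / of_nat (card B)"
    unfolding char_def by (rule self_similar_integral[OF assms, where K=1]) auto
  also have "(\<Sum>a\<in>B. LINT x|\<mu>. iexp (s * (inverse \<rho> * (x + a))))
     = (\<Sum>a\<in>B. iexp (s * (inverse \<rho> * a)) * char \<mu> (s * inverse \<rho>))"
  proof (rule sum.cong)
    fix a
    have *: "iexp (s * (inverse \<rho> * (x + a))) = iexp (s * (inverse \<rho> * a)) * iexp (s * inverse \<rho> * x)" for x
      unfolding exp_add[symmetric] of_real_add[symmetric] distrib_left[symmetric]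
      by (simp add: algebra_simps)
    show "(LINT x|\<mu>. iexp (s * (inverse \<rho> * (x + a)))) = iexp (s * (inverse \<rho> * a)) * char \<mu> (s * inverse \<rho>)"
      unfolding * char_def by simp
  qed simp
  finally show ?thesis by (simp add: sum_distrib_right)
qed

text \<open>Both characteristic functions obey the same recursion, whose factor has modulus at most
  1. Hence their difference at \<open>s\<close> is bounded by that at \<open>s / \<rho> ^ n\<close>,
  which tends to 0 by continuity at 0, and Levy's uniqueness theorem applies.\<close>

lemma self_similar_unique:
  assumes \<mu>: "self_similar \<rho> B \<mu>" and \<nu>: "self_similar \<rho> B \<nu>"
    and B: "finite B" "B \<noteq> {}" and \<rho>: "\<rho> > 1"
  shows "\<mu> = \<nu>"
proof (rule Levy_uniqueness)
  show R: "real_distribution \<mu>" "real_distribution \<nu>"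
    using \<mu> \<nu> by (auto intro: self_similar_real_distribution)
  interpret \<mu>: real_distribution \<mu> by fact
  interpret \<nu>: real_distribution \<nu> by fact
  define d where "d s = norm (char \<mu> s - char \<nu> s)" for s
  have step: "d s \<le> d (s * inverse \<rho>)" for s
  proof -
    define m where "m = (\<Sum>a\<in>B. iexp (s * (inverse \<rho> * a))) / of_nat (card B)"
    have "norm (\<Sum>a\<in>B. iexp (s * (inverse \<rho> * a))) \<le> (\<Sum>a\<in>B. 1)"
      by (rule sum_norm_le) auto
    then have "norm m \<le> 1"
      by (simp add: m_def norm_divide divide_le_eq)
    moreover have "d s = norm m * d (s * inverse \<rho>)"
      unfolding d_def self_similar_char[OF \<mu> B, of s] self_similar_char[OF \<nu> B, of s]
        m_def[symmetric] right_diff_distrib[symmetric] norm_mult ..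
    ultimately show ?thesis
      using mult_right_mono[of "norm m" 1 "d (s * inverse \<rho>)"] by (simp add: d_def)
  qed
  have iter: "d s \<le> d (s * inverse \<rho> ^ n)" for s n
  proof (induction n)
    case (Suc n)
    then show ?case using step[of "s * inverse \<rho> ^ n"] by (simp add: mult_ac)
  qed simp
  have "d s = 0" for s
  proof -
    have "(\<lambda>n. s * inverse \<rho> ^ n) \<longlonglongrightarrow> s * 0"
      using \<rho> by (intro tendsto_mult tendsto_const LIMSEQ_power_zero) (simp add: inverse_less_1_iff)
    then have "(\<lambda>n. d (s * inverse \<rho> ^ n)) \<longlonglongrightarrow> norm (char \<mu> 0 - char \<nu> 0)"
      unfolding d_def
      by (intro tendsto_norm tendsto_diff isCont_tendsto_compose[OF \<mu>.isCont_char]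
          isCont_tendsto_compose[OF \<nu>.isCont_char]) auto
    then have "(\<lambda>n. d (s * inverse \<rho> ^ n)) \<longlonglongrightarrow> 0"
      by (simp add: \<mu>.char_zero \<nu>.char_zero)
    from LIMSEQ_le_const[OF this, of "d s"] have "d s \<le> 0"
      using iter by auto
    then show ?thesis by (simp add: d_def)
  qed
  then show "char \<mu> = char \<nu>"
    by (auto simp: d_def fun_eq_iff)
qed

text \<open>The measure is the law of the random series with terms
  \<open>w !! k / \<rho> ^ Suc k\<close>, where the digits are independent and uniform on
  \<open>B\<close>; a geometric series bounds its support.\<close>

lemma self_similar_exists:
  assumes B: "finite B" "B \<noteq> {}" and \<rho>: "\<rho> > 1"
  obtains \<mu> R where "self_similar \<rho> B \<mu>" "emeasure \<mu> (- {-R..R}) = 0"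
proof -
  define U where "U = uniform_count_measure B"
  interpret U: prob_space U
    using B unfolding U_def by (rule prob_space_uniform_count_measure)
  have spU: "space U = B" by (simp add: U_def space_uniform_count_measure)
  define S where "S = stream_space U"
  interpret S: prob_space S unfolding S_def by (rule U.prob_space_stream_space)
  have spS: "space S = streams B" by (simp add: S_def space_stream_space spU)
  have id: "(\<lambda>a::real. a) \<in> U \<rightarrow>\<^sub>M borel"
    by (subst measurable_cong_sets[of U "count_space B" borel borel])
       (simp_all add: U_def sets_uniform_count_measure_count_space)
  define r where "r = inverse \<rho>"
  have r: "0 < r" "r < 1" using \<rho> by (simp_all add: r_def inverse_less_1_iff)
  \<comment> \<open>The exponents start at 1 because \<open>x\<close> is mapped to
    \<open>r * (x + a)\<close>, which contracts the digit as well; thus prepending a digit to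
    \<open>w\<close> applies this map to \<open>X w\<close>.\<close>
  define X where "X w = (\<Sum>k. r ^ Suc k * w !! k)" for w :: "real stream"
  have [measurable]: "(\<lambda>w. w !! k) \<in> borel_measurable S" for k
    unfolding S_def by (rule measurable_compose[OF measurable_snth id])
  have X[measurable]: "X \<in> borel_measurable S"
    unfolding X_def by measurable
  obtain m where m: "\<And>a. a \<in> B \<Longrightarrow> \<bar>a\<bar> \<le> m"
    using finite_imp_bounded[OF B(1)] by (auto simp: bounded_iff)
  have geo: "summable (\<lambda>k. r ^ Suc k * m)"
    using r by (intro summable_mult2) (simp add: summable_geometric)
  have le: "norm (r ^ Suc k * w !! k) \<le> r ^ Suc k * m" if "w \<in> streams B" for w k
    using r m[OF snth_in[OF that, of k]] unfolding norm_mult real_norm_def abs_mult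
    by (intro mult_mono) auto
  have summable: "summable (\<lambda>k. r ^ Suc k * w !! k)" if "w \<in> streams B" for w
    by (rule summable_comparison_test[OF _ geo]) (use le[OF that] in blast)
  define R where "R = (\<Sum>k. r ^ Suc k * m)"
  have XR: "X w \<in> {-R..R}" if "w \<in> streams B" for w
  proof -
    have "norm (X w) \<le> R"
      unfolding X_def R_def by (rule norm_suminf_le[OF le[OF that] geo])
    then show ?thesis by auto
  qed
  have X_Cons: "X (a ## w) = r * (X w + a)" if "a \<in> B" "w \<in> streams B" for a w
  proof -
    have "a ## w \<in> streams B" using that by (simp add: streams_Stream)
    from suminf_split_head[OF summable[OF this]]
    have "X (a ## w) = r * a + (\<Sum>k. r * (r ^ Suc k * w !! k))"
      by (simp add: X_def mult.assoc)
    also have "(\<Sum>k. r * (r ^ Suc k * w !! k)) = r * X w"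
      unfolding X_def by (rule suminf_mult[OF summable[OF that(2)]])
    finally show ?thesis by (simp add: algebra_simps)
  qed
  define \<mu> where "\<mu> = distr S borel X"
  interpret \<mu>: prob_space \<mu> unfolding \<mu>_def by (rule S.prob_space_distr) fact
  have "measure \<mu> A = (1 / real (card B)) * (\<Sum>a\<in>B. measure \<mu> ((\<lambda>x. inverse \<rho> * (x + a)) -` A))"
    if A[measurable]: "A \<in> sets borel" for A
  proof -
    have m: "(\<lambda>x. r * (x + a)) -` A \<in> sets borel" for a
      using measurable_sets[of "\<lambda>x. r * (x + a)" borel borel A] by simp
    have "ennreal (measure \<mu> A) = emeasure S (X -` A \<inter> space S)"
      unfolding \<mu>.emeasure_eq_measure[symmetric] by (simp add: \<mu>_def emeasure_distr)
    \<comment> \<open>Conditioning on the first digit: the tail of the stream is again distributed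
      according to \<open>S\<close>.\<close>
    also have "\<dots> = (\<integral>\<^sup>+ a. emeasure S {w \<in> space S. a ## w \<in> X -` A \<inter> space S} \<partial>U)"
      unfolding S_def by (rule U.emeasure_stream_space) (simp flip: S_def)
    also have "\<dots> = (\<integral>\<^sup>+ a. emeasure \<mu> ((\<lambda>x. r * (x + a)) -` A) \<partial>U)"
    proof (rule nn_integral_cong)
      fix a assume "a \<in> space U"
      then have a: "a \<in> B" by (simp add: spU)
      then have "{w \<in> space S. a ## w \<in> X -` A \<inter> space S}
          = X -` ((\<lambda>x. r * (x + a)) -` A) \<inter> space S"
        by (auto simp: spS X_Cons streams_Stream)
      then show "emeasure S {w \<in> space S. a ## w \<in> X -` A \<inter> space S}
          = emeasure \<mu> ((\<lambda>x. r * (x + a)) -` A)"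
        by (simp add: \<mu>_def emeasure_distr[OF X m])
    qed
    also have "\<dots> = (\<Sum>a\<in>B. ennreal (1 / card B) * emeasure \<mu> ((\<lambda>x. r * (x + a)) -` A))"
      unfolding U_def uniform_count_measure_def using B
      by (simp add: nn_integral_point_measure_finite)
    also have "\<dots> = ennreal (\<Sum>a\<in>B. (1 / card B) * measure \<mu> ((\<lambda>x. r * (x + a)) -` A))"
      by (simp add: \<mu>.emeasure_eq_measure sum_ennreal flip: ennreal_mult')
    finally show ?thesis
      by (subst (asm) ennreal_inj) (auto intro!: sum_nonneg simp: sum_distrib_left r_def)
  qed
  then have "self_similar \<rho> B \<mu>"
    unfolding self_similar_def by (auto simp: \<mu>_def S.prob_space_distr)
  moreover have "X -` (- {-R..R}) \<inter> space S = {}"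
    using XR by (auto simp: spS)
  then have "emeasure \<mu> (- {-R..R}) = 0"
    unfolding \<mu>_def by (subst emeasure_distr[OF X]) (auto simp del: atLeastAtMost_iff)
  ultimately show ?thesis by (rule that)
qed

lemma self_similar_measure:
  assumes "finite B" "B \<noteq> {}" "\<rho> > 1"
  shows "self_similar \<rho> B (self_similar_measure \<rho> B)"
    and "\<exists>R. emeasure (self_similar_measure \<rho> B) (- {-R..R}) = 0"
proof -
  obtain \<mu> R where \<mu>: "self_similar \<rho> B \<mu>" "emeasure \<mu> (- {-R..R}) = 0"
    using self_similar_exists[OF assms] .
  have "self_similar_measure \<rho> B = \<mu>"
    unfolding self_similar_measure_def
    using \<mu>(1) self_similar_unique[OF _ \<mu>(1) assms] by (rule the_equality)
  then show "self_similar \<rho> B (self_similar_measure \<rho> B)"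
    and "\<exists>R. emeasure (self_similar_measure \<rho> B) (- {-R..R}) = 0"
    using \<mu> by auto
qed

section \<open>Square-integrable functions\<close>

lemma L2_spaceD:
  assumes "f \<in> L2_space M"
  shows "f \<in> borel_measurable M" "integrable M (\<lambda>x. (norm (f x))\<^sup>2)"
  using assms by (auto simp: L2_space_def)

lemma L2_space_dominated:
  assumes f: "f \<in> borel_measurable M" and w: "integrable M w"
    and le: "\<And>x. (norm (f x))\<^sup>2 \<le> w x"
  shows "f \<in> L2_space M"
proof -
  note f[measurable]
  have "integrable M (\<lambda>x. (norm (f x))\<^sup>2)"
  proof (rule Bochner_Integration.integrable_bound[OF w])
    show "AE x in M. norm ((norm (f x))\<^sup>2) \<le> norm (w x)"
      using order_trans[OF le abs_ge_self] by simp
  qed simp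
  then show ?thesis using f by (simp add: L2_space_def)
qed

lemma norm_add_square_le: "(norm (a + b))\<^sup>2 \<le> 2 * (norm a)\<^sup>2 + 2 * (norm b)\<^sup>2"
  for a b :: "'a::real_normed_vector"
proof -
  have "(norm (a + b))\<^sup>2 \<le> (norm a + norm b)\<^sup>2"
    by (intro power_mono norm_triangle_ineq) simp
  also have "\<dots> \<le> 2 * (norm a)\<^sup>2 + 2 * (norm b)\<^sup>2"
    using sum_squares_bound[of "norm a" "norm b"] by (simp add: power2_sum)
  finally show ?thesis .
qed

lemma L2_space_add: "f \<in> L2_space M \<Longrightarrow> g \<in> L2_space M \<Longrightarrow> (\<lambda>x. f x + g x) \<in> L2_space M"
  by (rule L2_space_dominated[where w="\<lambda>x. 2 * (norm (f x))\<^sup>2 + 2 * (norm (g x))\<^sup>2"])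
     (auto dest: L2_spaceD
       intro!: norm_add_square_le borel_measurable_add Bochner_Integration.integrable_add)

lemma L2_space_scale: "f \<in> L2_space M \<Longrightarrow> (\<lambda>x. c * f x) \<in> L2_space M"
  by (auto simp: L2_space_def norm_mult power_mult_distrib)

lemma L2_space_zero: "(\<lambda>x. 0) \<in> L2_space M"
  by (simp add: L2_space_def)

lemma L2_space_diff: "f \<in> L2_space M \<Longrightarrow> g \<in> L2_space M \<Longrightarrow> (\<lambda>x. f x - g x) \<in> L2_space M"
  using L2_space_add[of f M "\<lambda>x. (-1) * g x"] L2_space_scale[of g M "-1"] by simp

lemma L2_space_sum: "(\<And>i. i \<in> F \<Longrightarrow> f i \<in> L2_space M) \<Longrightarrow> (\<lambda>x. \<Sum>i\<in>F. f i x) \<in> L2_space M"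
  by (induction F rule: infinite_finite_induct) (auto intro: L2_space_add L2_space_zero)

lemma L2_space_combination:
  "(\<And>i. i \<in> F \<Longrightarrow> e i \<in> L2_space M) \<Longrightarrow> (\<lambda>x. \<Sum>i\<in>F. c i * e i x) \<in> L2_space M"
  by (rule L2_space_sum) (rule L2_space_scale)

lemma integrable_L2_inner:
  assumes f: "f \<in> L2_space M" and g: "g \<in> L2_space M"
  shows "integrable M (\<lambda>x. f x * cnj (g x))"
proof (rule Bochner_Integration.integrable_bound)
  note L2_spaceD(1)[OF f, measurable] L2_spaceD(1)[OF g, measurable]
  show "integrable M (\<lambda>x. (norm (f x))\<^sup>2 + (norm (g x))\<^sup>2)"
    using L2_spaceD(2)[OF f] L2_spaceD(2)[OF g] by (rule Bochner_Integration.integrable_add)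
  show "AE x in M. norm (f x * cnj (g x)) \<le> norm ((norm (f x))\<^sup>2 + (norm (g x))\<^sup>2)"
  proof (rule AE_I2)
    fix x
    have "2 * (norm (f x) * norm (g x)) \<le> (norm (f x))\<^sup>2 + (norm (g x))\<^sup>2"
      using sum_squares_bound[of "norm (f x)" "norm (g x)"] by simp
    moreover have "0 \<le> norm (f x) * norm (g x)" by simp
    ultimately have "norm (f x) * norm (g x) \<le> (norm (f x))\<^sup>2 + (norm (g x))\<^sup>2" by linarith
    then show "norm (f x * cnj (g x)) \<le> norm ((norm (f x))\<^sup>2 + (norm (g x))\<^sup>2)"
      by (simp add: norm_mult)
  qed
  show "(\<lambda>x. f x * cnj (g x)) \<in> borel_measurable M"
    using measurable_compose[OF L2_spaceD(1)[OF g] borel_measurable_continuous_onI[of cnj]]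
    by (auto intro!: borel_measurable_times L2_spaceD[OF f] continuous_intros)
qed

lemma L2_inner_commute: "L2_inner M g f = cnj (L2_inner M f g)"
proof -
  have "L2_inner M g f = (LINT x|M. cnj (f x * cnj (g x)))"
    by (simp add: L2_inner_def mult.commute)
  also have "\<dots> = cnj (L2_inner M f g)"
    unfolding L2_inner_def by (rule Bochner_Integration.integral_cnj)
  finally show ?thesis .
qed

lemma L2_inner_diff_left:
  assumes "f \<in> L2_space M" "g \<in> L2_space M" "h \<in> L2_space M"
  shows "L2_inner M (\<lambda>x. f x - g x) h = L2_inner M f h - L2_inner M g h"
  using Bochner_Integration.integral_diff[OF integrable_L2_inner[OF assms(1,3)]
      integrable_L2_inner[OF assms(2,3)]]
  by (simp add: L2_inner_def left_diff_distrib)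

lemma L2_inner_combination_left:
  assumes "\<And>i. i \<in> F \<Longrightarrow> e i \<in> L2_space M" "h \<in> L2_space M"
  shows "L2_inner M (\<lambda>x. \<Sum>i\<in>F. c i * e i x) h = (\<Sum>i\<in>F. c i * L2_inner M (e i) h)"
  using Bochner_Integration.integral_sum[of F M "\<lambda>i x. c i * e i x * cnj (h x)"]
    integrable_L2_inner[OF L2_space_scale[OF assms(1)] assms(2)]
  by (simp add: L2_inner_def sum_distrib_right mult.assoc)

lemma L2_inner_combination_right:
  assumes "\<And>i. i \<in> F \<Longrightarrow> e i \<in> L2_space M" "h \<in> L2_space M"
  shows "L2_inner M h (\<lambda>x. \<Sum>i\<in>F. c i * e i x) = (\<Sum>i\<in>F. cnj (c i) * L2_inner M h (e i))"
  by (subst (1 2) L2_inner_commute) (simp add: L2_inner_combination_left[OF assms])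

lemma L2_norm_nonneg: "0 \<le> L2_norm M f"
  by (simp add: L2_norm_def)

lemma L2_norm_square: "(L2_norm M f)\<^sup>2 = (LINT x|M. (norm (f x))\<^sup>2)"
  by (simp add: L2_norm_def)

lemma L2_inner_self: "L2_inner M f f = of_real ((L2_norm M f)\<^sup>2)"
  unfolding L2_inner_def L2_norm_square complex_norm_square[symmetric]
  by (rule integral_complex_of_real)

lemma L2_norm_diff_square:
  assumes f: "f \<in> L2_space M" and g: "g \<in> L2_space M"
  shows "(L2_norm M (\<lambda>x. f x - g x))\<^sup>2
    = (L2_norm M f)\<^sup>2 - 2 * Re (L2_inner M f g) + (L2_norm M g)\<^sup>2"
proof -
  have d: "(\<lambda>x. f x - g x) \<in> L2_space M" using f g by (rule L2_space_diff)
  have right: "L2_inner M h (\<lambda>x. f x - g x) = L2_inner M h f - L2_inner M h g"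
    if "h \<in> L2_space M" for h
    by (subst (1 2 3) L2_inner_commute) (simp add: L2_inner_diff_left[OF f g that])
  have "of_real ((L2_norm M (\<lambda>x. f x - g x))\<^sup>2) = L2_inner M (\<lambda>x. f x - g x) (\<lambda>x. f x - g x)"
    by (simp only: L2_inner_self)
  also have "\<dots> = L2_inner M f f - L2_inner M f g - (cnj (L2_inner M f g) - L2_inner M g g)"
    by (simp add: L2_inner_diff_left[OF f g d] right[OF f] right[OF g] L2_inner_commute[of M g f])
  finally have "Re (of_real ((L2_norm M (\<lambda>x. f x - g x))\<^sup>2))
    = Re (L2_inner M f f - L2_inner M f g - (cnj (L2_inner M f g) - L2_inner M g g))" by simp
  then show ?thesis by (simp add: L2_inner_self)
qed

text \<open>A triangle inequality with constant 2, obtained from the pointwise bound without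
  Cauchy-Schwarz. It suffices for density arguments, where the constant is absorbed by taking
  \<open>\<epsilon> / 4\<close>.\<close>

lemma L2_norm_add_le:
  assumes f: "f \<in> L2_space M" and g: "g \<in> L2_space M"
  shows "L2_norm M (\<lambda>x. f x + g x) \<le> 2 * (L2_norm M f + L2_norm M g)"
proof (rule power2_le_imp_le)
  have "(L2_norm M (\<lambda>x. f x + g x))\<^sup>2 \<le> (LINT x|M. 2 * (norm (f x))\<^sup>2 + 2 * (norm (g x))\<^sup>2)"
    unfolding L2_norm_square using L2_space_add[OF f g] f g
    by (intro integral_mono norm_add_square_le Bochner_Integration.integrable_add) (auto dest: L2_spaceD)
  also have "\<dots> = 2 * (L2_norm M f)\<^sup>2 + 2 * (L2_norm M g)\<^sup>2"
    using f g by (simp add: L2_norm_square L2_spaceD)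
  also have "\<dots> \<le> (2 * (L2_norm M f + L2_norm M g))\<^sup>2"
    using L2_norm_nonneg[of M f] L2_norm_nonneg[of M g]
    by (simp add: power_mult_distrib power2_sum)
  finally show "(L2_norm M (\<lambda>x. f x + g x))\<^sup>2 \<le> (2 * (L2_norm M f + L2_norm M g))\<^sup>2" .
qed (simp add: L2_norm_nonneg)

lemma L2_norm_scale: "L2_norm M (\<lambda>x. c * f x) = norm c * L2_norm M f"
  by (simp add: L2_norm_def norm_mult power_mult_distrib real_sqrt_mult)

text \<open>Pythagoras for the projection to a finite orthonormal family. It yields both Bessel's
  inequality and the link between full energy and membership in the closed span.\<close>

lemma L2_projection_residual:
  assumes "finite F" and e: "\<And>i. i \<in> F \<Longrightarrow> e i \<in> L2_space M"
    and on: "\<And>i j. i \<in> F \<Longrightarrow> j \<in> F \<Longrightarrow> L2_inner M (e i) (e j) = (if i = j then 1 else 0)"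
    and f: "f \<in> L2_space M"
  shows "(L2_norm M (\<lambda>x. f x - (\<Sum>i\<in>F. L2_inner M f (e i) * e i x)))\<^sup>2
    = (L2_norm M f)\<^sup>2 - (\<Sum>i\<in>F. (norm (L2_inner M f (e i)))\<^sup>2)"
proof -
  define g where "g = (\<lambda>x. \<Sum>i\<in>F. L2_inner M f (e i) * e i x)"
  have g: "g \<in> L2_space M" unfolding g_def by (rule L2_space_combination) (rule e)
  have fg: "L2_inner M f g = of_real (\<Sum>i\<in>F. (norm (L2_inner M f (e i)))\<^sup>2)"
    unfolding g_def of_real_sum
    by (subst L2_inner_combination_right[OF e f])
       (simp_all only: complex_norm_square mult.commute)
  have "L2_inner M (e i) g = cnj (L2_inner M f (e i))" if "i \<in> F" for i
  proof -
    have "L2_inner M (e i) g = (\<Sum>j\<in>F. cnj (L2_inner M f (e j)) * (if i = j then 1 else 0))"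
      unfolding g_def
      by (subst L2_inner_combination_right[OF e e[OF that]]) (simp_all add: on[OF that])
    then show ?thesis using \<open>finite F\<close> that by (simp add: if_distrib cong: if_cong)
  qed
  then have "L2_inner M g g = of_real (\<Sum>i\<in>F. (norm (L2_inner M f (e i)))\<^sup>2)"
    by (subst (1) g_def, subst L2_inner_combination_left[OF e g])
       (simp_all add: complex_norm_square del: of_real_power)
  then have "(L2_norm M g)\<^sup>2 = (\<Sum>i\<in>F. (norm (L2_inner M f (e i)))\<^sup>2)"
    unfolding L2_inner_self of_real_eq_iff .
  then show ?thesis
    using L2_norm_diff_square[OF f g] unfolding fg by (simp add: g_def)
qed

section \<open>Closed linear spans and their stability under limits\<close>

definition L2_span_closure :: "'a measure \<Rightarrow> 'i set \<Rightarrow> ('i \<Rightarrow> 'a \<Rightarrow> complex) \<Rightarrow> ('a \<Rightarrow> complex) set" where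
  "L2_span_closure M I e = {f \<in> L2_space M. \<forall>\<epsilon>>0. \<exists>F c. finite F \<and> F \<subseteq> I \<and>
      L2_norm M (\<lambda>x. f x - (\<Sum>i\<in>F. c i * e i x)) < \<epsilon>}"

text \<open>The closed span is closed: an approximation of an approximation is an approximation, up
  to the constant 2 in \<open>L2_norm_add_le\<close>.\<close>

lemma L2_span_closureI:
  assumes e: "\<And>i. i \<in> I \<Longrightarrow> e i \<in> L2_space M" and f: "f \<in> L2_space M"
    and approx: "\<And>\<epsilon>. \<epsilon> > 0 \<Longrightarrow> \<exists>g\<in>L2_span_closure M I e. L2_norm M (\<lambda>x. f x - g x) < \<epsilon>"
  shows "f \<in> L2_span_closure M I e"
  unfolding L2_span_closure_def
proof (intro CollectI conjI f allI impI)
  fix \<epsilon> :: real assume "\<epsilon> > 0"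
  then obtain g where g: "g \<in> L2_span_closure M I e" "L2_norm M (\<lambda>x. f x - g x) < \<epsilon> / 4"
    using approx[of "\<epsilon> / 4"] by auto
  then have gL: "g \<in> L2_space M" by (simp add: L2_span_closure_def)
  obtain F c where F: "finite F" "F \<subseteq> I" "L2_norm M (\<lambda>x. g x - (\<Sum>i\<in>F. c i * e i x)) < \<epsilon> / 4"
    using g(1) \<open>\<epsilon> > 0\<close> unfolding L2_span_closure_def by (auto dest!: spec[of _ "\<epsilon> / 4"])
  have "(\<lambda>x. \<Sum>i\<in>F. c i * e i x) \<in> L2_space M"
    using F e by (intro L2_space_combination) auto
  then have "L2_norm M (\<lambda>x. (f x - g x) + (g x - (\<Sum>i\<in>F. c i * e i x)))
    \<le> 2 * (L2_norm M (\<lambda>x. f x - g x) + L2_norm M (\<lambda>x. g x - (\<Sum>i\<in>F. c i * e i x)))"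
    by (intro L2_norm_add_le L2_space_diff f gL)
  also have "\<dots> < \<epsilon>" using F g by auto
  finally show "\<exists>F c. finite F \<and> F \<subseteq> I \<and> L2_norm M (\<lambda>x. f x - (\<Sum>i\<in>F. c i * e i x)) < \<epsilon>"
    using F by auto
qed

lemma L2_span_closure_add:
  assumes e: "\<And>i. i \<in> I \<Longrightarrow> e i \<in> L2_space M"
    and f: "f \<in> L2_span_closure M I e" and g: "g \<in> L2_span_closure M I e"
  shows "(\<lambda>x. f x + g x) \<in> L2_span_closure M I e"
proof -
  have fL: "f \<in> L2_space M" and gL: "g \<in> L2_space M" using f g by (auto simp: L2_span_closure_def)
  show ?thesis
    unfolding L2_span_closure_def
  proof (intro CollectI conjI L2_space_add fL gL allI impI)
    fix \<epsilon> :: real assume "\<epsilon> > 0"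
    then have "\<epsilon> / 4 > 0" by simp
    obtain F c where F: "finite F" "F \<subseteq> I" "L2_norm M (\<lambda>x. f x - (\<Sum>i\<in>F. c i * e i x)) < \<epsilon> / 4"
      using f \<open>\<epsilon> / 4 > 0\<close> unfolding L2_span_closure_def by blast
    obtain G d where G: "finite G" "G \<subseteq> I" "L2_norm M (\<lambda>x. g x - (\<Sum>i\<in>G. d i * e i x)) < \<epsilon> / 4"
      using g \<open>\<epsilon> / 4 > 0\<close> unfolding L2_span_closure_def by blast
    \<comment> \<open>Both combinations are extended by zero to \<open>F \<union> G\<close>, where
      their coefficients can be added.\<close>
    define k where "k i = (if i \<in> F then c i else 0) + (if i \<in> G then d i else 0)" for i
    have *: "(\<Sum>i\<in>F \<union> G. k i * e i x) = (\<Sum>i\<in>F. c i * e i x) + (\<Sum>i\<in>G. d i * e i x)" for x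
    proof -
      have "(\<Sum>i\<in>F \<union> G. k i * e i x) = (\<Sum>i\<in>F \<union> G. if i \<in> F then c i * e i x else 0)
          + (\<Sum>i\<in>F \<union> G. if i \<in> G then d i * e i x else 0)"
        unfolding sum.distrib[symmetric] by (rule sum.cong) (auto simp: k_def distrib_right)
      then show ?thesis using F G by (simp add: sum.If_cases Int_absorb1 Int_absorb2)
    qed
    have "(\<lambda>x. f x - (\<Sum>i\<in>F. c i * e i x)) \<in> L2_space M" "(\<lambda>x. g x - (\<Sum>i\<in>G. d i * e i x)) \<in> L2_space M"
      using F G e by (auto intro!: L2_space_diff fL gL L2_space_combination)
    from L2_norm_add_le[OF this]
    have "L2_norm M (\<lambda>x. f x + g x - (\<Sum>i\<in>F \<union> G. k i * e i x)) < \<epsilon>"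
      using F G by (simp add: * algebra_simps)
    then show "\<exists>F c. finite F \<and> F \<subseteq> I \<and> L2_norm M (\<lambda>x. f x + g x - (\<Sum>i\<in>F. c i * e i x)) < \<epsilon>"
      using F G by (intro exI[of _ "F \<union> G"] exI[of _ k]) auto
  qed
qed

lemma L2_span_closure_scale:
  assumes f: "f \<in> L2_span_closure M I e"
  shows "(\<lambda>x. a * f x) \<in> L2_span_closure M I e"
  unfolding L2_span_closure_def
proof (intro CollectI conjI allI impI)
  show "(\<lambda>x. a * f x) \<in> L2_space M" using f by (auto simp: L2_span_closure_def intro: L2_space_scale)
  fix \<epsilon> :: real assume "\<epsilon> > 0"
  \<comment> \<open>The summand 1 keeps the denominator positive when \<open>a = 0\<close>.\<close>
  then have "\<epsilon> / (norm a + 1) > 0" by (intro divide_pos_pos) (auto simp: add_nonneg_pos)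
  then obtain F c where F: "finite F" "F \<subseteq> I" "L2_norm M (\<lambda>x. f x - (\<Sum>i\<in>F. c i * e i x)) < \<epsilon> / (norm a + 1)"
    using f unfolding L2_span_closure_def by blast
  have "L2_norm M (\<lambda>x. a * f x - (\<Sum>i\<in>F. (a * c i) * e i x))
      = norm a * L2_norm M (\<lambda>x. f x - (\<Sum>i\<in>F. c i * e i x))"
    unfolding L2_norm_scale[symmetric] by (simp add: algebra_simps sum_distrib_left)
  also have "\<dots> \<le> (norm a + 1) * L2_norm M (\<lambda>x. f x - (\<Sum>i\<in>F. c i * e i x))"
    by (intro mult_right_mono L2_norm_nonneg) simp
  also have "\<dots> < \<epsilon>"
    using F(3) pos_less_divide_eq[of "norm a + 1" _ \<epsilon>] by (simp add: add_nonneg_pos mult.commute)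
  finally show "\<exists>F c. finite F \<and> F \<subseteq> I \<and> L2_norm M (\<lambda>x. a * f x - (\<Sum>i\<in>F. c i * e i x)) < \<epsilon>"
    using F by (intro exI[of _ F] exI[of _ "\<lambda>i. a * c i"]) auto
qed

lemma L2_span_closure_zero: "(\<lambda>x. 0) \<in> L2_span_closure M I e"
  unfolding L2_span_closure_def by (auto intro!: L2_space_zero exI[of _ "{}"] simp: L2_norm_def)

text \<open>Dominated convergence turns almost everywhere limits into limits in norm. Every limit in
  the density proof below is taken in this way.\<close>

lemma L2_span_closure_dominated:
  assumes e: "\<And>i. i \<in> I \<Longrightarrow> e i \<in> L2_space M"
    and g: "\<And>n::nat. g n \<in> L2_span_closure M I e"
    and f: "f \<in> L2_space M"
    and lim: "AE x in M. (\<lambda>n. g n x) \<longlonglongrightarrow> f x"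
    and w: "integrable M w" and le: "\<And>n. AE x in M. (norm (f x - g n x))\<^sup>2 \<le> w x"
  shows "f \<in> L2_span_closure M I e"
proof (rule L2_span_closureI[OF e f])
  fix \<epsilon> :: real assume "\<epsilon> > 0"
  have gL: "g n \<in> L2_space M" for n using g[of n] by (simp add: L2_span_closure_def)
  note L2_spaceD(1)[OF gL, measurable] L2_spaceD(1)[OF f, measurable]
  have "(\<lambda>n. LINT x|M. (norm (f x - g n x))\<^sup>2) \<longlonglongrightarrow> (LINT x|M. 0)"
  proof (rule integral_dominated_convergence[OF _ _ w])
    show "AE x in M. (\<lambda>n. (norm (f x - g n x))\<^sup>2) \<longlonglongrightarrow> 0"
      using lim
    proof eventually_elim
      case (elim x)
      have "(\<lambda>n. (norm (f x - g n x))\<^sup>2) \<longlonglongrightarrow> (norm (f x - f x))\<^sup>2"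
        by (intro tendsto_intros elim)
      then show ?case by simp
    qed
  qed (use le in auto)
  then have "(\<lambda>n. L2_norm M (\<lambda>x. f x - g n x)) \<longlonglongrightarrow> sqrt 0"
    unfolding L2_norm_def by (intro tendsto_real_sqrt) simp
  then have "\<forall>\<^sub>F n in sequentially. L2_norm M (\<lambda>x. f x - g n x) < \<epsilon>"
    using \<open>\<epsilon> > 0\<close> by (intro order_tendstoD(2)) auto
  then obtain n where "L2_norm M (\<lambda>x. f x - g n x) < \<epsilon>"
    by (auto simp: eventually_sequentially)
  then show "\<exists>g\<in>L2_span_closure M I e. L2_norm M (\<lambda>x. f x - g x) < \<epsilon>"
    using g by blast
qed

section \<open>Density of exponentials\<close>

definition expo :: "real \<Rightarrow> real \<Rightarrow> complex" where
  "expo l x = exp (- 2 * complex_of_real pi * \<i> * complex_of_real (l * x))"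

lemma expo_cis: "expo l x = cis (- (2 * pi * l * x))"
  by (simp add: expo_def cis_conv_exp algebra_simps)

lemma expo_add: "expo (k + l) x = expo k x * expo l x"
  by (simp add: expo_cis cis_mult algebra_simps)

lemma cnj_expo: "cnj (expo l x) = expo (- l) x"
  by (simp add: expo_cis cis_cnj)

lemma expo_mult_cnj: "expo k x * cnj (expo l x) = expo (k - l) x"
  using expo_add[of k "- l" x] by (simp add: cnj_expo)

lemma expo_zero: "expo 0 x = 1"
  by (simp add: expo_cis)

lemma norm_expo: "norm (expo l x) = 1"
  by (simp add: expo_cis)

lemma continuous_expo: "continuous_on A (expo l)"
  unfolding expo_def by (intro continuous_intros)

lemma borel_measurable_expo: "expo l \<in> borel_measurable borel"
  by (rule borel_measurable_continuous_onI) (rule continuous_expo)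

section \<open>Trigonometric polynomials with arbitrary real frequencies\<close>

inductive trig_poly :: "(real \<Rightarrow> complex) \<Rightarrow> bool" where
  expo: "trig_poly (expo l)"
| add: "trig_poly f \<Longrightarrow> trig_poly g \<Longrightarrow> trig_poly (\<lambda>x. f x + g x)"
| scale: "trig_poly f \<Longrightarrow> trig_poly (\<lambda>x. c * f x)"

lemma trig_poly_const: "trig_poly (\<lambda>x. c)"
  using trig_poly.scale[OF trig_poly.expo[of 0], of c] by (simp add: expo_zero)

lemma trig_poly_continuous: "trig_poly f \<Longrightarrow> continuous_on A f"
  by (induction rule: trig_poly.induct) (intro continuous_expo continuous_intros; assumption)+

lemma trig_poly_mult_expo: "trig_poly f \<Longrightarrow> trig_poly (\<lambda>x. expo l x * f x)"
proof (induction rule: trig_poly.induct)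
  case (expo k)
  show ?case using trig_poly.expo[of "l + k"] by (simp add: expo_add[abs_def])
next
  case (add f g)
  then show ?case using trig_poly.add by (simp add: distrib_left)
next
  case (scale f c)
  then show ?case using trig_poly.scale[of "\<lambda>x. expo l x * f x" c] by (simp add: mult.left_commute)
qed

lemma trig_poly_mult: "trig_poly f \<Longrightarrow> trig_poly g \<Longrightarrow> trig_poly (\<lambda>x. f x * g x)"
proof (induction rule: trig_poly.induct)
  case (expo k)
  then show ?case by (rule trig_poly_mult_expo)
next
  case (add f h)
  then show ?case using trig_poly.add by (simp add: distrib_right)
next
  case (scale f c)
  then show ?case using trig_poly.scale[of "\<lambda>x. f x * g x" c] by (simp add: mult.assoc)
qed

lemma trig_poly_sin: "trig_poly (\<lambda>x. of_real (sin (2 * pi * l * x)))"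
proof -
  have "of_real (sin (2 * pi * l * x)) = (\<i> / 2) * expo l x + (- \<i> / 2) * expo (- l) x" for x
    by (simp add: expo_cis complex_eq_iff)
  then show ?thesis
    by (simp only:) (intro trig_poly.intros)
qed

text \<open>Stone-Weierstrass for the real functions whose complexification is a trigonometric
  polynomial: they form an algebra with constants, and sines separate points.\<close>

lemma trig_poly_approx:
  fixes g :: "real \<Rightarrow> real"
  assumes "continuous_on {-R..R} g" "\<epsilon> > 0"
  shows "\<exists>p. trig_poly (\<lambda>x. of_real (p x)) \<and> (\<forall>x\<in>{-R..R}. \<bar>g x - p x\<bar> < \<epsilon>)"
proof (rule Stone_Weierstrass_HOL[where P="\<lambda>p. trig_poly (\<lambda>x. of_real (p x))"])
  fix x y assume xy: "x \<in> {-R..R} \<and> y \<in> {-R..R} \<and> x \<noteq> y"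
  \<comment> \<open>With this frequency the argument of the sine is \<open>pi / 2 * (x / R)\<close>,
    which stays in the interval where the sine is injective.\<close>
  define l where "l = 1 / (4 * R)"
  have R: "R > 0" using xy by auto
  have b: "- (pi/2) \<le> 2 * pi * l * z \<and> 2 * pi * l * z \<le> pi/2" if "z \<in> {-R..R}" for z
  proof -
    have "2 * pi * l * z = pi / 2 * (z / R)" by (simp add: l_def)
    moreover have "-1 \<le> z / R" "z / R \<le> 1" using that R by (auto simp: field_simps)
    ultimately show ?thesis
      using mult_left_mono[of "-1" "z / R" "pi / 2"] mult_left_mono[of "z / R" 1 "pi / 2"] by simp
  qed
  have "sin (2 * pi * l * x) \<noteq> sin (2 * pi * l * y)"
    using sin_inj_pi[of "2 * pi * l * x" "2 * pi * l * y"] b[of x] b[of y] xy R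
    by (auto simp: l_def)
  then show "\<exists>f. trig_poly (\<lambda>x. of_real (f x)) \<and> f x \<noteq> f y"
    by (intro exI[of _ "\<lambda>x. sin (2 * pi * l * x)"] conjI trig_poly_sin)
next
  fix f :: "real \<Rightarrow> real" assume "trig_poly (\<lambda>x. of_real (f x))"
  from continuous_on_Re[OF trig_poly_continuous[OF this]]
  show "continuous_on {-R..R} f" by simp
next
  fix f g :: "real \<Rightarrow> real"
  assume "trig_poly (\<lambda>x. of_real (f x)) \<and> trig_poly (\<lambda>x. of_real (g x))"
  then show "trig_poly (\<lambda>x. of_real (f x + g x))" "trig_poly (\<lambda>x. of_real (f x * g x))"
    using trig_poly.add trig_poly_mult by auto
qed (use assms in \<open>auto intro: trig_poly_const\<close>)

lemma bounded_in_L2_space: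
  assumes "finite_measure M" "f \<in> borel_measurable M" "\<And>x. norm (f x) \<le> K"
  shows "f \<in> L2_space M"
proof (rule L2_space_dominated[OF assms(2)])
  show "integrable M (\<lambda>_. K\<^sup>2)"
    using assms(1) by (rule finite_measure.integrable_const)
  show "(norm (f x))\<^sup>2 \<le> K\<^sup>2" for x
    using assms(3) by (intro power_mono) auto
qed

lemma expo_in_L2_space: "finite_measure M \<Longrightarrow> sets M = sets borel \<Longrightarrow> expo l \<in> L2_space M"
  using borel_measurable_expo[of l] measurable_cong_sets[of M borel borel borel]
  by (intro bounded_in_L2_space[where K=1]) (auto simp: norm_expo)

text \<open>The span is enlarged step by step: trigonometric polynomials, bounded continuous
  functions, indicators of half-lines, indicators of Borel sets, simple functions, and finally all
  square-integrable functions.\<close>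

lemma L2_span_closure_expo_dense:
  fixes \<mu> :: "real measure"
  assumes "finite_measure \<mu>" and s\<mu>[measurable_cong]: "sets \<mu> = sets borel"
    and supp: "emeasure \<mu> (- {-R..R}) = 0"
    and e: "\<And>i. i \<in> I \<Longrightarrow> e i \<in> L2_space \<mu>"
    and expo: "\<And>l. expo l \<in> L2_span_closure \<mu> I e"
    and f: "f \<in> L2_space \<mu>"
  shows "f \<in> L2_span_closure \<mu> I e"
proof -
  interpret finite_measure \<mu> by fact
  define V where "V = L2_span_closure \<mu> I e"
  have sp: "space \<mu> = UNIV" using s\<mu> by (metis sets_eq_imp_space_eq space_borel)
  have mb: "g \<in> borel_measurable \<mu> \<longleftrightarrow> g \<in> borel_measurable borel" for g :: "real \<Rightarrow> complex"
    by (rule arg_cong[where f="\<lambda>S. g \<in> S"], rule measurable_cong_sets) (simp_all add: s\<mu>)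
  have V_sum: "(\<lambda>x. \<Sum>i\<in>F. g i x) \<in> V" if "\<And>i. i \<in> F \<Longrightarrow> g i \<in> V"
    for F :: "'k set" and g :: "'k \<Rightarrow> real \<Rightarrow> complex"
    using that unfolding V_def
    by (induction F rule: infinite_finite_induct)
       (auto intro: L2_span_closure_add[OF e] L2_span_closure_zero)
  have AE_supp: "AE x in \<mu>. x \<in> {-R..R}"
  proof (rule AE_I')
    show "- {-R..R} \<in> null_sets \<mu>" using supp by (auto simp: null_sets_def s\<mu>)
  qed auto
  have V_poly: "p \<in> V" if "trig_poly p" for p
    using that unfolding V_def
    by (induction rule: trig_poly.induct)
       (auto intro: expo L2_span_closure_add[OF e] L2_span_closure_scale)
  \<comment> \<open>The approximation is uniform only on \<open>{-R..R}\<close>, but this interval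
    carries \<open>\<mu>\<close>.\<close>
  have V_cont: "(\<lambda>x. of_real (g x)) \<in> V"
    if g: "continuous_on UNIV g" "\<And>x. \<bar>g x\<bar> \<le> 1" for g :: "real \<Rightarrow> real"
  proof -
    have "\<exists>p. trig_poly (\<lambda>x. of_real (p x)) \<and> (\<forall>x\<in>{-R..R}. \<bar>g x - p x\<bar> < inverse (real (Suc n)))" for n
      by (rule trig_poly_approx) (use g in \<open>auto intro: continuous_on_subset\<close>)
    then obtain p where p: "\<And>n. trig_poly (\<lambda>x. of_real (p n x))"
      "\<And>n x. x \<in> {-R..R} \<Longrightarrow> \<bar>g x - p n x\<bar> < inverse (real (Suc n))" by metis
    show ?thesis
      unfolding V_def
    proof (rule L2_span_closure_dominated[OF e])
      show "(\<lambda>x. of_real (p n x)) \<in> L2_span_closure \<mu> I e" for n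
        using V_poly[OF p(1)] by (simp add: V_def)
      show "(\<lambda>x. complex_of_real (g x)) \<in> L2_space \<mu>"
        using g by (intro bounded_in_L2_space[where K=1])
          (auto simp: mb finite_measure_axioms intro!: borel_measurable_continuous_onI continuous_intros)
      show "AE x in \<mu>. (\<lambda>n. complex_of_real (p n x)) \<longlonglongrightarrow> complex_of_real (g x)"
        using AE_supp
      proof eventually_elim
        case (elim x)
        have "(\<lambda>n. p n x - g x) \<longlonglongrightarrow> 0"
          by (rule Lim_null_comparison[OF _ LIMSEQ_inverse_real_of_nat])
             (use p(2)[OF elim] in \<open>auto intro!: always_eventually less_imp_le simp: abs_minus_commute\<close>)
        then show ?case by (intro tendsto_of_real) (simp add: LIM_zero_iff)
      qed
      show "AE x in \<mu>. (norm (complex_of_real (g x) - complex_of_real (p n x)))\<^sup>2 \<le> 1" for n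
        using AE_supp
      proof eventually_elim
        case (elim x)
        have "\<bar>g x - p n x\<bar> \<le> 1"
          using p(2)[OF elim, of n] inverse_le_1_iff[of "real (Suc n)"] by linarith
        then show ?case
          by (simp add: abs_square_le_1 flip: of_real_diff)
      qed
    qed auto
  qed
  have ind_L2: "(indicator A :: real \<Rightarrow> complex) \<in> L2_space \<mu>" if "A \<in> sets borel" for A
    using that by (intro bounded_in_L2_space[where K=1])
      (auto simp: finite_measure_axioms indicator_def s\<mu>)
  have V_atMost: "(indicator {..a} :: real \<Rightarrow> complex) \<in> V" for a
    unfolding V_def
  proof (rule L2_span_closure_dominated[OF e])
    \<comment> \<open>A continuous ramp falling from 1 at \<open>a\<close> to 0 at
      \<open>a + 1 / n\<close>; for \<open>n = 0\<close> it is the constant 1.\<close>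
    define g where "g n x = max 0 (min 1 (1 - real n * (x - a)))" for n x
    show "(\<lambda>x. of_real (g n x)) \<in> L2_span_closure \<mu> I e" for n
      unfolding V_def[symmetric]
    proof (rule V_cont)
      show "continuous_on UNIV (g n)"
        unfolding g_def by (intro continuous_intros)
    qed (auto simp: g_def)
    show "(indicator {..a} :: real \<Rightarrow> complex) \<in> L2_space \<mu>" by (rule ind_L2) simp
    show "AE x in \<mu>. (\<lambda>n. complex_of_real (g n x)) \<longlonglongrightarrow> indicator {..a} x"
    proof (rule AE_I2)
      fix x
      show "(\<lambda>n. complex_of_real (g n x)) \<longlonglongrightarrow> indicator {..a} x"
      proof (cases "x \<le> a")
        case True
        then have "real n * (x - a) \<le> 0" for n by (simp add: mult_nonneg_nonpos)
        then have "g n x = 1" for n by (simp add: g_def)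
        then show ?thesis using True by simp
      next
        case False
        then obtain m where m: "1 < real m * (x - a)" using reals_Archimedean3[of "x - a"] by auto
        have "g n x = 0" if "n \<ge> m" for n
        proof -
          have "real m * (x - a) \<le> real n * (x - a)" using that False by (intro mult_right_mono) auto
          then show ?thesis using m by (simp add: g_def)
        qed
        then have "\<forall>\<^sub>F n in sequentially. complex_of_real (g n x) = 0"
          by (auto simp: eventually_sequentially)
        then show ?thesis using False by (simp add: tendsto_eventually)
      qed
    qed
    show "AE x in \<mu>. (norm (indicator {..a} x - complex_of_real (g n x)))\<^sup>2 \<le> 1" for n
    proof (rule AE_I2)
      fix x
      have "indicator {..a} x - complex_of_real (g n x) = of_real (indicator {..a} x - g n x)"
        by (simp add: indicator_def)
      moreover have "\<bar>indicator {..a} x - g n x\<bar> \<le> 1" by (auto simp: g_def indicator_def)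
      ultimately show "(norm (indicator {..a} x - complex_of_real (g n x)))\<^sup>2 \<le> 1"
        by (simp only: norm_of_real abs_square_le_1 abs_abs)
    qed
  qed auto
  have V_ind: "(indicator A :: real \<Rightarrow> complex) \<in> V" if "A \<in> sets borel" for A
  proof -
    have eq: "sets (borel :: real measure) = sigma_sets UNIV (range atMost)"
      by (subst borel_eq_atMost) simp
    \<comment> \<open>Dynkin's theorem: the half-lines generate the Borel sets and are stable under
      intersection, so complements and disjoint unions are all that remains to check.\<close>
    have "Int_stable (range atMost :: real set set)" by (auto simp: Int_stable_def)
    moreover have "range atMost \<subseteq> Pow (UNIV :: real set)" by simp
    moreover have "A \<in> sigma_sets UNIV (range atMost)" using that eq by simp
    ultimately show ?thesis
    proof (induction rule: sigma_sets_induct_disjoint)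
      case (basic A) then show ?case using V_atMost by auto
    next
      case empty
      then show ?case using L2_span_closure_zero[of \<mu> I e] by (simp add: V_def indicator_def[abs_def])
    next
      case (compl A)
      have one: "(\<lambda>x. 1) \<in> V" using V_poly[OF trig_poly_const] .
      have "(\<lambda>x. 1 + (-1) * indicator A x :: complex) \<in> V"
        using L2_span_closure_add[OF e one[unfolded V_def] L2_span_closure_scale[OF compl.IH[unfolded V_def]]]
        unfolding V_def .
      moreover have "(\<lambda>x. 1 + (-1) * indicator A x :: complex) = indicator (UNIV - A)"
        by (auto simp: indicator_def)
      ultimately show ?case by simp
    next
      case (union A)
      then have A: "A i \<in> sets borel" for i using eq by auto
      show ?case
        unfolding V_def
      proof (rule L2_span_closure_dominated[OF e])
        have fin: "(indicator (\<Union>i<n. A i) :: real \<Rightarrow> complex) = (\<lambda>x. \<Sum>i<n. indicator (A i) x)" for n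
          using union.hyps(1)
          by (intro ext indicator_UN_disjoint) (auto intro: disjoint_family_on_mono[of _ UNIV])
        show "(indicator (\<Union>i<n. A i) :: real \<Rightarrow> complex) \<in> L2_span_closure \<mu> I e" for n
          unfolding fin V_def[symmetric] by (rule V_sum) (rule union.IH)
        show "(indicator (\<Union>(range A)) :: real \<Rightarrow> complex) \<in> L2_space \<mu>"
          using A by (intro ind_L2) auto
        show "AE x in \<mu>. (\<lambda>n. indicator (\<Union>i<n. A i) x :: complex) \<longlonglongrightarrow> indicator (\<Union>(range A)) x"
          by (intro AE_I2 LIMSEQ_indicator_UN)
        show "AE x in \<mu>. (norm (indicator (\<Union>(range A)) x - indicator (\<Union>i<n. A i) x :: complex))\<^sup>2 \<le> 1" for n
          by (auto simp: indicator_def)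
      qed auto
    qed
  qed
  have V_simple: "g \<in> V" if g: "simple_function \<mu> g" for g :: "real \<Rightarrow> complex"
  proof -
    have fin: "finite (range g)" and m: "\<And>y. g -` {y} \<in> sets borel"
      using simple_functionD[OF g] by (auto simp: sp s\<mu>)
    have "(\<lambda>x. \<Sum>y\<in>range g. y * indicator (g -` {y}) x) \<in> V"
      using V_ind[OF m] unfolding V_def by (intro V_sum[unfolded V_def] L2_span_closure_scale)
    also have "(\<lambda>x. \<Sum>y\<in>range g. y * indicator (g -` {y}) x) = g"
    proof
      fix x
      have "(\<Sum>y\<in>range g. y * indicator (g -` {y}) x) = (\<Sum>y\<in>range g. if y = g x then y else 0)"
        by (rule sum.cong) (auto simp: indicator_def)
      then show "(\<Sum>y\<in>range g. y * indicator (g -` {y}) x) = g x"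
        using fin by simp
    qed
    finally show ?thesis .
  qed
  note fm = L2_spaceD[OF f]
  \<comment> \<open>The bound \<open>2 * norm (f x)\<close> on the simple functions gives error at
    most \<open>3 * norm (f x)\<close>, hence the dominating function with factor 9.\<close>
  obtain s where s: "\<And>i. simple_function \<mu> (s i)" "\<And>x. (\<lambda>i. s i x) \<longlonglongrightarrow> f x"
    "\<And>i x. norm (s i x) \<le> 2 * norm (f x)"
    using borel_measurable_implies_sequence_metric[OF fm(1), of 0] by (auto simp: sp)
  show ?thesis
  proof (rule L2_span_closure_dominated[OF e, where g=s])
    show "s n \<in> L2_span_closure \<mu> I e" for n using V_simple[OF s(1)] by (simp add: V_def)
    show "integrable \<mu> (\<lambda>x. 9 * (norm (f x))\<^sup>2)" using fm by simp
    show "AE x in \<mu>. (norm (f x - s n x))\<^sup>2 \<le> 9 * (norm (f x))\<^sup>2" for n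
    proof (rule AE_I2)
      fix x
      have "norm (f x - s n x) \<le> 3 * norm (f x)"
        using norm_triangle_ineq4[of "f x" "s n x"] s(3)[of n x] by linarith
      from power_mono[OF this, of 2] show "(norm (f x - s n x))\<^sup>2 \<le> 9 * (norm (f x))\<^sup>2"
        by (simp add: power_mult_distrib)
    qed
  qed (use s f in auto)
qed

section \<open>Means of characters\<close>

lemma expo_commute: "expo l x = expo x l"
  by (simp add: expo_def mult.commute)

lemma expo_eq_1_iff: "expo l x = 1 \<longleftrightarrow> l * x \<in> \<int>"
proof
  assume "expo l x = 1"
  then obtain n :: int where "- 2 * pi * (l * x) = of_int (2 * n) * pi"
    unfolding expo_def exp_eq_1 by auto
  then have "pi * (l * x) = pi * of_int (- n)" by simp
  then have "l * x = of_int (- n)" unfolding mult_cancel_left by simp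
  then show "l * x \<in> \<int>" by (simp only: Ints_of_int)
next
  assume "l * x \<in> \<int>"
  then obtain n where n: "l * x = of_int n" by (auto elim: Ints_cases)
  have "expo l x = cis (2 * pi * of_int (- n))"
    using n by (simp add: expo_cis mult.assoc)
  also have "\<dots> = 1" by (rule cis_multiple_2pi) simp
  finally show "expo l x = 1" .
qed

lemma expo_power: "expo y (real d) = expo y 1 ^ d"
proof -
  have "- (2 * pi * y * real d) = real d * - (2 * pi * y * 1)" by simp
  then show ?thesis unfolding expo_cis Complex.DeMoivre by (rule arg_cong)
qed

lemma expo_conv_mult: "expo l x = expo (l * x) 1"
  by (simp add: expo_def)

text \<open>This is the function \<open>M\<close> of the overview, the Fourier transform of the
  uniform distribution on the digits below \<open>N\<close>.\<close>

definition char_mean :: "nat \<Rightarrow> real \<Rightarrow> complex" where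
  "char_mean N y = (\<Sum>d<N. expo y (real d)) / of_nat N"

text \<open>The geometric sum is stated without division, so that it also covers integers
  \<open>y\<close>, where both sides vanish.\<close>

lemma char_mean_geometric: "(1 - expo y 1) * (of_nat N * char_mean N y) = 1 - expo (real N * y) 1"
proof (cases "N = 0")
  case False
  then have "of_nat N * char_mean N y = (\<Sum>d<N. expo y 1 ^ d)"
    by (simp add: char_mean_def expo_power[symmetric])
  moreover have "expo y 1 ^ N = expo (real N * y) 1"
    by (simp add: expo_power[symmetric]) (simp add: expo_def mult_ac)
  ultimately show ?thesis by (metis one_diff_power_eq)
qed (simp add: expo_zero)

lemma char_mean_Ints:
  assumes "y \<in> \<int>" "N > 0"
  shows "char_mean N y = 1"
proof -
  have "expo y (real d) = 1" for d
    using assms by (simp add: expo_eq_1_iff)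
  then show ?thesis using assms by (simp add: char_mean_def)
qed

lemma char_mean_eq_0: "real N * y \<in> \<int> \<Longrightarrow> y \<notin> \<int> \<Longrightarrow> char_mean N y = 0"
  using char_mean_geometric[of y N] expo_eq_1_iff[of y 1] expo_eq_1_iff[of "real N * y" 1]
  by (cases "N = 0") (auto simp: char_mean_def)

lemma char_mean_neq_0: "real N * y \<notin> \<int> \<Longrightarrow> char_mean N y \<noteq> 0"
  using char_mean_geometric[of y N] expo_eq_1_iff[of "real N * y" 1] by auto

lemma char_mean_add_Ints:
  assumes "k \<in> \<int>"
  shows "char_mean N (y + k) = char_mean N y"
proof -
  have "expo k (real d) = 1" for d
    using assms by (simp add: expo_eq_1_iff)
  then show ?thesis by (simp add: char_mean_def expo_add)
qed

lemma divide_nat_Ints_iff: "N > 0 \<Longrightarrow> of_int k / real N \<in> \<int> \<longleftrightarrow> int N dvd k"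
proof
  assume "N > 0" "of_int k / real N \<in> \<int>"
  then obtain m where "of_int k = real N * of_int m" by (auto elim!: Ints_cases simp: field_simps)
  then have "real_of_int k = of_int (int N * m)" by simp
  then show "int N dvd k" unfolding of_int_eq_iff by simp
qed (auto elim!: dvdE)

lemma sum_expo_interval:
  "(\<Sum>c\<in>{a..<a + int N}. expo y (of_int c)) = expo y (of_int a) * (of_nat N * char_mean N y)"
proof -
  have "(\<Sum>c\<in>{a..<a + int N}. expo y (of_int c)) = (\<Sum>d<N. expo y (of_int (a + int d)))"
    by (rule sum.reindex_bij_witness[of _ "\<lambda>d. a + int d" "\<lambda>c. nat (c - a)"]) auto
  also have "\<dots> = expo y (of_int a) * (\<Sum>d<N. expo y (real d))"
    by (simp add: expo_commute[of y] expo_add sum_distrib_left)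
  finally show ?thesis by (cases "N = 0") (simp_all add: char_mean_def)
qed

text \<open>Expand the square into pairs of digits \<open>d\<close>, \<open>d'\<close> and sum over
  \<open>c\<close> first. As \<open>t\<close> is invertible modulo \<open>N\<close> and
  \<open>c\<close> runs through a complete residue system, only the \<open>N\<close> diagonal pairs
  survive. This makes the weights of the random walk sum to 1.\<close>

lemma sum_char_mean_square:
  assumes N: "N > 0" and t: "coprime t (int N)"
  shows "(\<Sum>c\<in>{a..<a + int N}. (norm (char_mean N ((\<xi> - of_int (t * c)) / real N)))\<^sup>2) = 1"
proof -
  define y where "y c = (\<xi> - of_int (t * c)) / real N" for c
  \<comment> \<open>\<open>u d d'\<close> is the frequency with which the product of the
    \<open>d\<close>-th character and the conjugate of the \<open>d'\<close>-th one oscillates in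
    \<open>c\<close>.\<close>
  define u where "u d d' = - of_int (t * (int d - int d')) / real N" for d d'
  have S: "(\<Sum>c\<in>{a..<a + int N}. expo (u d d') (of_int c)) = (if d = d' then of_nat N else 0)"
    if "d < N" "d' < N" for d d'
  proof (cases "d = d'")
    case True
    then show ?thesis using N unfolding sum_expo_interval by (simp add: u_def expo_zero char_mean_Ints)
  next
    case False
    have "\<not> int N dvd int d - int d'"
      using that False zdvd_imp_le[of "int N" "int d - int d'"] zdvd_imp_le[of "int N" "int d' - int d"]
      by (auto simp: dvd_diff_commute[of "int N" "int d"] not_less linorder_neq_iff)
    then have "\<not> int N dvd - (t * (int d - int d'))"
      using t by (simp add: coprime_commute coprime_dvd_mult_right_iff)
    then have "u d d' \<notin> \<int>"
      using divide_nat_Ints_iff[OF N, of "- (t * (int d - int d'))"] by (simp add: u_def)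
    moreover have "real N * u d d' \<in> \<int>" using N by (simp add: u_def)
    ultimately show ?thesis using False unfolding sum_expo_interval by (simp add: char_mean_eq_0)
  qed
  have split: "expo (y c) (real d) * cnj (expo (y c) (real d'))
      = expo (\<xi> / real N) (real d - real d') * expo (u d d') (of_int c)" for c d d'
  proof -
    have "(real d - real d') * y c = \<xi> / real N * (real d - real d') + u d d' * of_int c"
      using N by (simp add: y_def u_def field_simps)
    then show ?thesis
      unfolding expo_commute[of "y c"] expo_mult_cnj expo_conv_mult[of "real d - real d'"]
        expo_conv_mult[of "\<xi> / real N"] expo_conv_mult[of "u d d'"] by (simp only: expo_add)
  qed
  have "of_nat N ^ 2 * of_real (\<Sum>c\<in>{a..<a + int N}. (norm (char_mean N (y c)))\<^sup>2)
      = (\<Sum>c\<in>{a..<a + int N}. \<Sum>d<N. \<Sum>d'<N. expo (y c) (real d) * cnj (expo (y c) (real d')))"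
  proof -
    have "of_nat N ^ 2 * of_real ((norm (char_mean N (y c)))\<^sup>2)
        = (\<Sum>d<N. expo (y c) (real d)) * cnj (\<Sum>d<N. expo (y c) (real d))" for c
      using N unfolding complex_norm_square by (simp add: char_mean_def power2_eq_square)
    then show ?thesis
      by (simp only: of_real_sum sum_distrib_left) (simp add: sum_product)
  qed
  also have "\<dots> = (\<Sum>d<N. \<Sum>c\<in>{a..<a + int N}. \<Sum>d'<N. expo (y c) (real d) * cnj (expo (y c) (real d')))"
    by (rule sum.swap)
  also have "\<dots> = (\<Sum>d<N. \<Sum>d'<N. \<Sum>c\<in>{a..<a + int N}. expo (y c) (real d) * cnj (expo (y c) (real d')))"
    by (intro sum.cong refl sum.swap)
  also have "\<dots> = (\<Sum>d<N. \<Sum>d'<N. expo (\<xi> / real N) (real d - real d') * (if d = d' then of_nat N else 0))"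
    unfolding split sum_distrib_left[symmetric] by (intro sum.cong refl) (simp add: S)
  also have "\<dots> = of_nat N ^ 2"
    by (simp add: if_distrib expo_commute expo_zero power2_eq_square cong: if_cong)
  finally have "of_real (\<Sum>c\<in>{a..<a + int N}. (norm (char_mean N (y c)))\<^sup>2) = (1 :: complex)"
    using N by simp
  then show ?thesis unfolding y_def of_real_eq_1_iff .
qed

section \<open>Harmonicity of the projected energy\<close>

text \<open>The digits are any \<open>N\<close> consecutive integers that include 0. Digits and
  multiplier are of type \<open>int\<close>, so that divisibility is available; the locale is used
  both for \<open>t\<close> and for \<open>t / gcd t b\<close>.\<close>

locale digit_spectrum =
  fixes N q b :: nat and a t :: int and \<mu> :: "real measure"
  assumes N: "N \<ge> 2" and q: "q \<ge> 2" and b: "b = q * N"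
    and a: "a \<le> 0" "0 < a + int N"
    and t: "t \<noteq> 0" "coprime t (int N)"
    and self_similar: "self_similar (real b) ((\<lambda>d. real q * d) ` real ` {0..<N}) \<mu>"
    and support: "\<exists>R. emeasure \<mu> (- {-R..R}) = 0"
begin

abbreviation C :: "int set" where
  "C \<equiv> {a..<a + int N}"

text \<open>Expansions with \<open>n\<close> digits, built by adding a new lowest digit. This
  matches the self-similarity \<open>\<Lambda> = C + b \<Lambda>\<close>.\<close>

fun freqs :: "nat \<Rightarrow> int set" where
  "freqs 0 = {0}"
| "freqs (Suc n) = (\<lambda>(c, l). c + int b * l) ` (C \<times> freqs n)"

definition ft :: "real \<Rightarrow> complex" where
  "ft \<xi> = (LINT x|\<mu>. expo \<xi> x)"

text \<open>The nonzero cycles of \<open>x \<mapsto> (x - t c) / b\<close> in \<open>\<int>\<close> are traps, but traps need not be periodic.\<close>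

definition trap :: "int set \<Rightarrow> bool" where
  "trap E \<longleftrightarrow> E \<noteq> {} \<and> 0 \<notin> E \<and> (\<forall>x\<in>E. \<exists>c\<in>C. \<exists>y\<in>E. x = t * c + int b * y)"

text \<open>By the orthonormality proved below, this is the squared norm of the projection of
  \<open>expo \<xi>\<close> to the span of the frequencies in \<open>t * freqs n\<close>.\<close>

definition energy :: "nat \<Rightarrow> real \<Rightarrow> real" where
  "energy n \<xi> = (\<Sum>l\<in>freqs n. (norm (ft (\<xi> - of_int (t * l))))\<^sup>2)"

lemma b_gt: "b \<ge> 4" "b > 0"
  using N q mult_le_mono[of 2 q 2 N] by (auto simp: b)

lemma prob_space_\<mu>: "prob_space \<mu>" and sets_\<mu>: "sets \<mu> = sets borel"
  using self_similar by (auto simp: self_similar_def)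

lemma finite_measure_\<mu>: "finite_measure \<mu>"
  using prob_space_\<mu> by (rule prob_space.finite_measure)

section \<open>The Fourier transform of \<open>\<mu>\<close> and its refinement equation\<close>

lemma expo_L2: "expo l \<in> L2_space \<mu>"
  by (rule expo_in_L2_space[OF finite_measure_\<mu> sets_\<mu>])

lemma inner_expo: "L2_inner \<mu> (expo k) (expo l) = ft (k - l)"
  by (simp add: L2_inner_def ft_def expo_mult_cnj)

lemma ft_0: "ft 0 = 1"
  by (simp add: ft_def expo_zero prob_space.prob_space[OF prob_space_\<mu>])

lemma norm_expo_L2: "(L2_norm \<mu> (expo l))\<^sup>2 = 1"
  by (simp add: L2_norm_square norm_expo prob_space.prob_space[OF prob_space_\<mu>])

lemma isCont_ft: "isCont ft \<xi>"
proof -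
  interpret real_distribution \<mu> by (rule self_similar_real_distribution[OF self_similar])
  have "expo s x = iexp (- (2 * pi * s) * x)" for s x
    by (simp add: expo_def mult_ac)
  then have "ft = (\<lambda>s. char \<mu> (- (2 * pi * s)))"
    by (intro ext) (simp only: ft_def char_def)
  then show ?thesis
    using isCont_o2[of \<xi> "\<lambda>s. - (2 * pi * s)" "char \<mu>", OF _ isCont_char] by simp
qed

text \<open>Self-similarity applied to a character: as \<open>q / b = 1 / N\<close>, the
  translations by \<open>q * d\<close> contribute exactly \<open>char_mean N\<close> at
  \<open>\<xi> / N\<close>.\<close>

lemma ft_refine: "ft \<xi> = char_mean N (\<xi> / real N) * ft (\<xi> / real b)"
proof -
  let ?B = "(\<lambda>d. real q * d) ` real ` {0..<N}"
  have inj: "inj_on (\<lambda>d. real q * d) (real ` {0..<N})" "inj_on real {0..<N}"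
    using q by (auto simp: inj_on_def)
  then have card: "card ?B = N" by (simp add: card_image)
  have B: "finite ?B" "?B \<noteq> {}" using N by auto
  have "expo \<xi> (inverse (real b) * (x + real q * real d))
      = expo (\<xi> / real N) (real d) * expo (\<xi> / real b) x" for x d
  proof -
    have "\<xi> * (inverse (real b) * (x + real q * real d)) = \<xi> / real N * real d + \<xi> / real b * x"
      using N q by (simp add: b field_simps)
    then show ?thesis
      unfolding expo_conv_mult[of \<xi>] expo_conv_mult[of "\<xi> / real N"] expo_conv_mult[of "\<xi> / real b"]
      by (simp only: expo_add)
  qed
  then have *: "(LINT x|\<mu>. expo \<xi> (inverse (real b) * (x + real q * real d)))
      = expo (\<xi> / real N) (real d) * ft (\<xi> / real b)" for d
    by (simp add: ft_def)
  have "ft \<xi> = (\<Sum>d\<in>{0..<N}. expo (\<xi> / real N) (real d) * ft (\<xi> / real b)) / of_nat N"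
    unfolding ft_def[of \<xi>]
    by (subst self_similar_integral[OF self_similar B borel_measurable_expo, where K=1])
       (simp_all add: norm_expo card sum.reindex[OF inj(1)] sum.reindex[OF inj(2)] *)
  then show ?thesis by (simp add: char_mean_def sum_distrib_right atLeast0LessThan)
qed

lemma ft_eq_0: "\<not> int N dvd k \<Longrightarrow> ft (of_int k) = 0"
  using N divide_nat_Ints_iff[of N k] char_mean_eq_0[of N "of_int k / real N"]
  by (subst ft_refine) simp

text \<open>Here the mean of characters is evaluated at the integer \<open>q * k\<close>, where it
  equals 1.\<close>

lemma ft_scale: "ft (of_int (int b * k)) = ft (of_int k)"
proof -
  have "of_int (int b * k) / real N = of_int (int q * k)" "of_int (int b * k) / real b = of_int k"
    using N q by (simp_all add: b)
  then show ?thesis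
    using N by (subst ft_refine) (simp only: char_mean_Ints Ints_of_int, simp)
qed

section \<open>Digit expansions and orthogonality of their exponentials\<close>

lemma N_dvd_b: "int N dvd int b * k"
  by (simp add: b)

text \<open>Coprimality cancels \<open>t\<close>, and the \<open>N\<close> consecutive integers in
  \<open>C\<close> are pairwise incongruent modulo \<open>N\<close>.\<close>

lemma dvd_digit_diff:
  assumes "c \<in> C" "c' \<in> C" "int N dvd t * (c - c')"
  shows "c = c'"
proof -
  have "int N dvd c - c'"
    using assms(3) t(2) by (simp add: coprime_commute coprime_dvd_mult_right_iff)
  moreover have "\<bar>c - c'\<bar> < int N" using assms(1,2) by auto
  ultimately show ?thesis using zdvd_imp_le[of "int N" "\<bar>c - c'\<bar>"] by fastforce
qed

lemma digit_expansion_inj: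
  assumes "c \<in> C" "c' \<in> C" "c + int b * l = c' + int b * l'"
  shows "c = c' \<and> l = l'"
proof -
  have "c - c' = int b * (l' - l)"
    using assms(3) by (simp add: right_diff_distrib)
  then have "int N dvd t * (c - c')" using N_dvd_b dvd_mult by metis
  then have "c = c'" using assms(1,2) by (intro dvd_digit_diff)
  then show ?thesis using assms(3) b_gt by simp
qed

lemma finite_freqs: "finite (freqs n)"
  by (induction n) auto

lemma zero_in_digits: "0 \<in> C"
  using a by simp

text \<open>Since 0 is a digit, an expansion can be padded with a leading zero.\<close>

lemma freqs_Suc_mono: "freqs n \<subseteq> freqs (Suc n)"
proof (induction n)
  case 0
  have "(\<lambda>(c, l). c + int b * l) (0, 0) \<in> freqs (Suc 0)"
    unfolding freqs.simps by (rule imageI) (use zero_in_digits in auto)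
  then show ?case by simp
next
  case (Suc n)
  have "(\<lambda>(c, l). c + int b * l) ` (C \<times> freqs n) \<subseteq> (\<lambda>(c, l). c + int b * l) ` (C \<times> freqs (Suc n))"
    using Suc by (intro image_mono Sigma_mono) auto
  then show ?case unfolding freqs.simps(2)[symmetric] .
qed

lemma freqs_mono: "m \<le> n \<Longrightarrow> freqs m \<subseteq> freqs n"
  by (rule lift_Suc_mono_le[of freqs]) (rule freqs_Suc_mono)

text \<open>Compare lowest digits. If they differ, \<open>N\<close> does not divide the difference
  of the frequencies and \<open>ft\<close> vanishes there; if they agree, the difference is a
  multiple of \<open>b\<close> and \<open>ft_scale\<close> passes to the remaining digits.\<close>

lemma freqs_orthogonal:
  "l \<in> freqs n \<Longrightarrow> l' \<in> freqs n \<Longrightarrow> l \<noteq> l' \<Longrightarrow> ft (of_int (t * l) - of_int (t * l')) = 0"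
proof (induction n arbitrary: l l')
  case (Suc n)
  then obtain c m c' m' where l: "c \<in> C" "m \<in> freqs n" "l = c + int b * m"
    and l': "c' \<in> C" "m' \<in> freqs n" "l' = c' + int b * m'" by auto
  have eq: "t * l - t * l' = t * (c - c') + int b * (t * m - t * m')"
    by (simp add: l l' algebra_simps)
  show ?case
  proof (cases "c = c'")
    case True
    then have "m \<noteq> m'" using Suc.prems l l' by auto
    then have "ft (of_int (t * m - t * m')) = 0" using Suc.IH[OF l(2) l'(2)] by simp
    then have "ft (of_int (t * l - t * l')) = 0"
      unfolding eq using ft_scale[of "t * m - t * m'"] True by simp
    then show ?thesis by simp
  next
    case False
    then have "\<not> int N dvd t * (c - c')" using dvd_digit_diff l l' by blast
    then have "\<not> int N dvd t * l - t * l'"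
      unfolding eq using dvd_add_left_iff[OF N_dvd_b] by blast
    from ft_eq_0[OF this] show ?thesis by simp
  qed
qed simp

lemma orthonormal:
  assumes "l \<in> (\<Union>n. freqs n)" "l' \<in> (\<Union>n. freqs n)"
  shows "L2_inner \<mu> (expo (of_int (t * l))) (expo (of_int (t * l'))) = (if l = l' then 1 else 0)"
proof -
  obtain m n where "l \<in> freqs m" "l' \<in> freqs n" using assms by auto
  then have "l \<in> freqs (max m n)" "l' \<in> freqs (max m n)"
    using freqs_mono[of m "max m n"] freqs_mono[of n "max m n"] by auto
  then show ?thesis
    using freqs_orthogonal[of l "max m n" l'] by (auto simp: inner_expo ft_0)
qed

section \<open>Bessel's inequality, and the total energy as a continuous limit\<close>

lemma projection_residual:
  assumes f: "f \<in> L2_space \<mu>"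
  shows "(L2_norm \<mu> (\<lambda>x. f x - (\<Sum>l\<in>freqs n. L2_inner \<mu> f (expo (of_int (t * l))) * expo (of_int (t * l)) x)))\<^sup>2
    = (L2_norm \<mu> f)\<^sup>2 - (\<Sum>l\<in>freqs n. (norm (L2_inner \<mu> f (expo (of_int (t * l)))))\<^sup>2)"
  by (rule L2_projection_residual[OF finite_freqs expo_L2 orthonormal f]) auto

lemma Bessel:
  assumes f: "f \<in> L2_space \<mu>"
  shows "L2_set (\<lambda>l. norm (L2_inner \<mu> f (expo (of_int (t * l))))) (freqs n) \<le> L2_norm \<mu> f"
proof -
  have "(\<Sum>l\<in>freqs n. (norm (L2_inner \<mu> f (expo (of_int (t * l)))))\<^sup>2) \<le> (L2_norm \<mu> f)\<^sup>2"
    using projection_residual[OF f, of n]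
      zero_le_power2[of "L2_norm \<mu> (\<lambda>x. f x -
        (\<Sum>l\<in>freqs n. L2_inner \<mu> f (expo (of_int (t * l))) * expo (of_int (t * l)) x))"]
    by linarith
  from real_sqrt_le_mono[OF this] show ?thesis by (simp add: L2_set_def L2_norm_nonneg)
qed

lemma energy_eq_L2_set: "sqrt (energy n \<xi>) = L2_set (\<lambda>l. norm (ft (\<xi> - of_int (t * l)))) (freqs n)"
  by (simp add: L2_set_def energy_def)

text \<open>The root of the energy is the Euclidean norm of the coefficient vector of
  \<open>expo \<xi>\<close>. The triangle inequality and Bessel for
  \<open>expo \<xi> - expo \<eta>\<close> give a bound that does not depend on
  \<open>n\<close>.\<close>

lemma sqrt_energy_diff:
  "sqrt (energy n \<xi>) \<le> sqrt (energy n \<eta>) + sqrt (2 - 2 * Re (ft (\<xi> - \<eta>)))"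
proof -
  let ?f = "\<lambda>x. expo \<xi> x - expo \<eta> x"
  have f: "?f \<in> L2_space \<mu>" by (intro L2_space_diff expo_L2)
  have inner: "ft (\<xi> - of_int (t * l)) = ft (\<eta> - of_int (t * l)) + L2_inner \<mu> ?f (expo (of_int (t * l)))" for l
    using L2_inner_diff_left[OF expo_L2 expo_L2 expo_L2, of \<xi> \<eta> "of_int (t * l)"]
    by (simp add: inner_expo)
  have "sqrt (energy n \<xi>) \<le> L2_set (\<lambda>l. norm (ft (\<eta> - of_int (t * l)))
      + norm (L2_inner \<mu> ?f (expo (of_int (t * l))))) (freqs n)"
    unfolding energy_eq_L2_set inner by (intro L2_set_mono norm_triangle_ineq norm_ge_zero)
  also have "\<dots> \<le> sqrt (energy n \<eta>) + L2_set (\<lambda>l. norm (L2_inner \<mu> ?f (expo (of_int (t * l))))) (freqs n)"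
    unfolding energy_eq_L2_set by (rule L2_set_triangle_ineq)
  also have "\<dots> \<le> sqrt (energy n \<eta>) + L2_norm \<mu> ?f"
    using Bessel[OF f] by simp
  also have "L2_norm \<mu> ?f = sqrt ((L2_norm \<mu> ?f)\<^sup>2)"
    by (simp add: L2_norm_nonneg)
  also have "(L2_norm \<mu> ?f)\<^sup>2 = 2 - 2 * Re (ft (\<xi> - \<eta>))"
    unfolding L2_norm_diff_square[OF expo_L2 expo_L2] by (simp add: inner_expo norm_expo_L2)
  finally show ?thesis .
qed

lemma energy_le_1: "energy n \<xi> \<le> 1"
  using projection_residual[OF expo_L2, of \<xi> n]
    zero_le_power2[of "L2_norm \<mu> (\<lambda>x. expo \<xi> x -
      (\<Sum>l\<in>freqs n. L2_inner \<mu> (expo \<xi>) (expo (of_int (t * l))) * expo (of_int (t * l)) x))"]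
  unfolding energy_def inner_expo norm_expo_L2 by linarith

lemma energy_nonneg: "0 \<le> energy n \<xi>"
  unfolding energy_def by (intro sum_nonneg) simp

lemma energy_incseq: "incseq (\<lambda>n. energy n \<xi>)"
  unfolding energy_def
  by (intro incseq_SucI sum_mono2 finite_freqs freqs_Suc_mono) simp

text \<open>The function \<open>Q\<close> of the overview.\<close>

definition total_energy :: "real \<Rightarrow> real" where
  "total_energy \<xi> = (SUP n. energy n \<xi>)"

lemma energy_tendsto: "(\<lambda>n. energy n \<xi>) \<longlonglongrightarrow> total_energy \<xi>"
  unfolding total_energy_def
  by (rule LIMSEQ_incseq_SUP[OF _ energy_incseq]) (auto intro!: bdd_aboveI[of _ 1] energy_le_1)

lemma total_energy_le_1: "total_energy \<xi> \<le> 1"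
  using energy_tendsto by (rule LIMSEQ_le_const2) (auto intro: energy_le_1)

lemma total_energy_0: "total_energy 0 = 1"
proof (rule antisym[OF total_energy_le_1])
  have "energy 0 0 \<le> total_energy 0"
    by (rule incseq_le[OF energy_incseq energy_tendsto])
  then show "1 \<le> total_energy 0" by (simp add: energy_def ft_0)
qed

text \<open>The estimate \<open>sqrt_energy_diff\<close> is uniform in \<open>n\<close>, so it
  survives the limit, and its error term tends to 0 by continuity of \<open>ft\<close> at 0.\<close>

lemma isCont_total_energy: "isCont total_energy \<xi>"
proof -
  define s where "s \<eta> = sqrt (total_energy \<eta>)" for \<eta>
  \<comment> \<open>Both orders of the difference occur because the one-sided estimate is applied in
    both directions.\<close>
  define \<delta> where "\<delta> \<eta> = sqrt (2 - 2 * Re (ft (\<xi> - \<eta>))) + sqrt (2 - 2 * Re (ft (\<eta> - \<xi>)))" for \<eta>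
  have le: "s \<eta> \<le> s \<zeta> + sqrt (2 - 2 * Re (ft (\<eta> - \<zeta>)))" for \<eta> \<zeta>
  proof (rule LIMSEQ_le)
    show "(\<lambda>n. sqrt (energy n \<eta>)) \<longlonglongrightarrow> s \<eta>"
      unfolding s_def by (intro tendsto_real_sqrt energy_tendsto)
    show "(\<lambda>n. sqrt (energy n \<zeta>) + sqrt (2 - 2 * Re (ft (\<eta> - \<zeta>))))
        \<longlonglongrightarrow> s \<zeta> + sqrt (2 - 2 * Re (ft (\<eta> - \<zeta>)))"
      unfolding s_def by (intro tendsto_add tendsto_real_sqrt tendsto_const energy_tendsto)
  qed (use sqrt_energy_diff in auto)
  \<comment> \<open>This quantity is the squared norm of
    \<open>expo \<eta> - expo 0\<close>.\<close>
  have nonneg: "0 \<le> 2 - 2 * Re (ft \<eta>)" for \<eta>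
    using L2_norm_diff_square[OF expo_L2 expo_L2, of \<eta> 0]
      zero_le_power2[of "L2_norm \<mu> (\<lambda>x. expo \<eta> x - expo 0 x)"]
    unfolding inner_expo norm_expo_L2 by simp
  have bound: "norm (s \<eta> - s \<xi>) \<le> \<delta> \<eta>" for \<eta>
    using le[of \<eta> \<xi>] le[of \<xi> \<eta>] real_sqrt_ge_zero[OF nonneg[of "\<xi> - \<eta>"]]
      real_sqrt_ge_zero[OF nonneg[of "\<eta> - \<xi>"]]
    unfolding \<delta>_def real_norm_def by linarith
  have "((\<lambda>\<eta>. \<xi> - \<eta>) \<longlongrightarrow> \<xi> - \<xi>) (at \<xi>)" "((\<lambda>\<eta>. \<eta> - \<xi>) \<longlongrightarrow> \<xi> - \<xi>) (at \<xi>)"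
    by (intro tendsto_diff tendsto_const tendsto_ident_at)+
  from this[THEN isCont_tendsto_compose[OF isCont_ft]]
  have "((\<lambda>\<eta>. ft (\<xi> - \<eta>)) \<longlongrightarrow> ft 0) (at \<xi>)" "((\<lambda>\<eta>. ft (\<eta> - \<xi>)) \<longlongrightarrow> ft 0) (at \<xi>)"
    by simp_all
  then have "(\<delta> \<longlongrightarrow> sqrt (2 - 2 * Re (ft 0)) + sqrt (2 - 2 * Re (ft 0))) (at \<xi>)"
    unfolding \<delta>_def
    by (intro tendsto_add tendsto_real_sqrt tendsto_diff tendsto_mult tendsto_const tendsto_Re)
  then have "(\<delta> \<longlongrightarrow> 0) (at \<xi>)" by (simp add: ft_0)
  then have "((\<lambda>\<eta>. s \<eta> - s \<xi>) \<longlongrightarrow> 0) (at \<xi>)"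
    by (rule Lim_null_comparison[rotated]) (simp add: bound always_eventually del: real_norm_def)
  then have "(s \<longlongrightarrow> s \<xi>) (at \<xi>)" by (simp add: LIM_zero_iff)
  then have "((\<lambda>\<eta>. (s \<eta>)\<^sup>2) \<longlongrightarrow> (s \<xi>)\<^sup>2) (at \<xi>)" by (rule tendsto_power)
  moreover have "(s \<eta>)\<^sup>2 = total_energy \<eta>" for \<eta>
    using LIMSEQ_le_const[OF energy_tendsto, of 0 \<eta>] energy_nonneg by (simp add: s_def)
  ultimately show ?thesis by (simp add: isCont_def)
qed

section \<open>The random walk and harmonicity\<close>

definition weight :: "real \<Rightarrow> int \<Rightarrow> real" where
  "weight \<xi> c = (norm (char_mean N ((\<xi> - of_int (t * c)) / real N)))\<^sup>2"

definition child :: "real \<Rightarrow> int \<Rightarrow> real" where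
  "child \<xi> c = (\<xi> - of_int (t * c)) / real b"

lemma weight_sum: "(\<Sum>c\<in>C. weight \<xi> c) = 1"
  unfolding weight_def using N t by (intro sum_char_mean_square) auto

text \<open>Splitting off the lowest digit turns the sum over \<open>freqs (Suc n)\<close> into one
  step of the walk: \<open>ft_refine\<close> produces the weight, and the other factors form the
  energy at the child.\<close>

lemma energy_Suc: "energy (Suc n) \<xi> = (\<Sum>c\<in>C. weight \<xi> c * energy n (child \<xi> c))"
proof -
  have inj: "inj_on (\<lambda>(c, l). c + int b * l) (C \<times> freqs n)"
  proof (rule inj_onI)
    fix x y assume xy: "x \<in> C \<times> freqs n" "y \<in> C \<times> freqs n"
      "(case x of (c, l) \<Rightarrow> c + int b * l) = (case y of (c, l) \<Rightarrow> c + int b * l)"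
    show "x = y"
      using digit_expansion_inj[of "fst x" "fst y" "snd x" "snd y"] xy
      by (metis case_prod_beta mem_Times_iff prod_eq_iff)
  qed
  have summand: "(norm (ft (\<xi> - of_int (t * (c + int b * l)))))\<^sup>2
      = weight \<xi> c * (norm (ft (child \<xi> c - of_int (t * l))))\<^sup>2" for c l
  proof -
    \<comment> \<open>The higher digits shift the argument of the mean by a multiple of
      \<open>b / N = q\<close>, an integer, so they do not affect the weight.\<close>
    have "(\<xi> - of_int (t * (c + int b * l))) / real N
        = (\<xi> - of_int (t * c)) / real N + of_int (- (t * int q * l))"
      using N by (simp add: b field_simps)
    moreover have "(\<xi> - of_int (t * (c + int b * l))) / real b = child \<xi> c - of_int (t * l)"
      using b_gt by (simp add: child_def field_simps)
    ultimately have "ft (\<xi> - of_int (t * (c + int b * l)))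
        = char_mean N ((\<xi> - of_int (t * c)) / real N) * ft (child \<xi> c - of_int (t * l))"
      by (subst ft_refine) (simp only: char_mean_add_Ints Ints_of_int)
    then show ?thesis by (simp only: weight_def norm_mult power_mult_distrib)
  qed
  have "energy (Suc n) \<xi>
      = (\<Sum>(c, l)\<in>C \<times> freqs n. weight \<xi> c * (norm (ft (child \<xi> c - of_int (t * l))))\<^sup>2)"
    unfolding energy_def freqs.simps sum.reindex[OF inj] comp_def
    by (intro sum.cong refl) (auto simp only: summand split: prod.split)
  also have "\<dots> = (\<Sum>c\<in>C. weight \<xi> c * energy n (child \<xi> c))"
    unfolding energy_def sum_distrib_left by (rule sum.cartesian_product[symmetric])
  finally show ?thesis .
qed

lemma total_energy_harmonic: "total_energy \<xi> = (\<Sum>c\<in>C. weight \<xi> c * total_energy (child \<xi> c))"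
proof (rule LIMSEQ_unique)
  show "(\<lambda>n. energy (Suc n) \<xi>) \<longlonglongrightarrow> total_energy \<xi>"
    by (rule LIMSEQ_Suc[OF energy_tendsto])
  show "(\<lambda>n. energy (Suc n) \<xi>) \<longlonglongrightarrow> (\<Sum>c\<in>C. weight \<xi> c * total_energy (child \<xi> c))"
    unfolding energy_Suc by (intro tendsto_sum tendsto_mult tendsto_const energy_tendsto)
qed

end

section \<open>Traps and completeness\<close>

text \<open>A trap gives \<open>x\<close> a digit expansion that never ends at 0, which is compared
  with that of \<open>t * l\<close> as in \<open>freqs_orthogonal\<close>: distinct lowest digits
  make \<open>ft\<close> vanish, equal ones are removed by \<open>ft_scale\<close>.\<close>

lemma (in digit_spectrum) trap_ft_eq_0:
  assumes E: "trap E" and "x \<in> E" "l \<in> freqs n"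
  shows "ft (of_int (x - t * l)) = 0"
  using assms(2,3)
proof (induction n arbitrary: x l)
  case 0
  \<comment> \<open>Only the frequency 0 remains, and the claim is proved by descent on the absolute
    value of \<open>x\<close>.\<close>
  have "ft (of_int x) = 0" if "x \<in> E" for x
    using that
  proof (induction "nat \<bar>x\<bar>" arbitrary: x rule: less_induct)
    case less
    then obtain c y where cy: "c \<in> C" "y \<in> E" "x = t * c + int b * y"
      using E unfolding trap_def by blast
    show ?case
    proof (cases "int N dvd x")
      case True
      \<comment> \<open>Divisibility by \<open>N\<close> forces the digit 0, so
        \<open>x = b * y\<close>. As 0 is not in the trap, \<open>y\<close> is nonzero and the
        descent is strict.\<close>
      then have "int N dvd t * (c - 0)"
        using dvd_add_left_iff[OF N_dvd_b, of "t * c" y] cy by simp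
      then have "c = 0" using cy(1) zero_in_digits by (rule dvd_digit_diff[rotated 2])
      then have x: "x = int b * y" using cy by simp
      have "y \<noteq> 0" using E cy(2) by (auto simp: trap_def)
      then have "\<bar>y\<bar> < \<bar>x\<bar>" using b_gt by (simp add: x abs_mult)
      then have "ft (of_int y) = 0" using less.hyps[of y] cy(2) by simp
      then show ?thesis using ft_scale[of y] by (simp add: x)
    qed (rule ft_eq_0)
  qed
  with 0 show ?case by simp
next
  case (Suc n)
  then obtain c m where l: "c \<in> C" "m \<in> freqs n" "l = c + int b * m" by auto
  obtain c' y where x: "c' \<in> C" "y \<in> E" "x = t * c' + int b * y"
    using E Suc.prems(1) unfolding trap_def by blast
  have eq: "x - t * l = t * (c' - c) + int b * (y - t * m)"
    by (simp add: l x algebra_simps)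
  show ?case
  proof (cases "c' = c")
    case True
    then show ?thesis
      unfolding eq using ft_scale[of "y - t * m"] Suc.IH[OF x(2) l(2)] by simp
  next
    case False
    then have "\<not> int N dvd t * (c' - c)" using dvd_digit_diff l x by blast
    then have "\<not> int N dvd x - t * l"
      unfolding eq using dvd_add_left_iff[OF N_dvd_b] by blast
    then show ?thesis by (rule ft_eq_0)
  qed
qed

text \<open>For \<open>x\<close> in the trap, \<open>expo x\<close> is a unit vector orthogonal to
  the whole system, so its distance to any finite combination is at least 1.\<close>

lemma (in digit_spectrum) trap_imp_not_basis:
  assumes E: "trap E"
  shows "\<not> L2_orthonormal_basis \<mu> (\<Union>n. freqs n) (\<lambda>l. expo (of_int (t * l)))"
proof
  assume basis: "L2_orthonormal_basis \<mu> (\<Union>n. freqs n) (\<lambda>l. expo (of_int (t * l)))"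
  obtain x where x: "x \<in> E" using E by (auto simp: trap_def)
  obtain F c where F: "finite F" "F \<subseteq> (\<Union>n. freqs n)"
    "L2_norm \<mu> (\<lambda>y. expo (of_int x) y - (\<Sum>l\<in>F. c l * expo (of_int (t * l)) y)) < 1"
    using basis[unfolded L2_orthonormal_basis_def, THEN conjunct2, THEN conjunct2,
        rule_format, OF expo_L2[of "of_int x"] zero_less_one] by (elim exE conjE)
  let ?g = "\<lambda>y. \<Sum>l\<in>F. c l * expo (of_int (t * l)) y"
  have g: "?g \<in> L2_space \<mu>" by (intro L2_space_combination expo_L2)
  have "L2_inner \<mu> (expo (of_int x)) ?g
      = (\<Sum>l\<in>F. cnj (c l) * ft (of_int x - of_int (t * l)))"
    unfolding inner_expo[symmetric] by (intro L2_inner_combination_right expo_L2)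
  also have "\<dots> = 0"
  proof (intro sum.neutral ballI)
    fix l assume "l \<in> F"
    then obtain n where "l \<in> freqs n" using F by auto
    from trap_ft_eq_0[OF E x this]
    show "cnj (c l) * ft (of_int x - of_int (t * l)) = 0" by simp
  qed
  finally have "(L2_norm \<mu> (\<lambda>y. expo (of_int x) y - ?g y))\<^sup>2 \<ge> 1"
    unfolding L2_norm_diff_square[OF expo_L2 g] by (simp add: norm_expo_L2)
  moreover have "(L2_norm \<mu> (\<lambda>y. expo (of_int x) y - ?g y))\<^sup>2 < 1"
    using power_strict_mono[OF F(3) L2_norm_nonneg, of 2] by simp
  ultimately show False by simp
qed

text \<open>A minimiser of the total energy that is not an integer can be divided by \<open>b\<close> forever, staying a
  minimiser, so the minimum is the value \<open>1\<close> at \<open>0\<close>; hence otherwise the minimisers form a trap.\<close>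

lemma (in digit_spectrum) no_trap_imp_total_energy:
  assumes no_trap: "\<nexists>E. trap E"
  shows "total_energy \<xi> = 1"
proof (rule ccontr)
  assume "total_energy \<xi> \<noteq> 1"
  then have less: "total_energy \<xi> < 1" using total_energy_le_1[of \<xi>] by simp
  \<comment> \<open>The interval \<open>{-R..R}\<close> contains \<open>\<xi>\<close> and is mapped
    into itself by every move of the walk: \<open>x - t * c\<close> has modulus at most
    \<open>2 * R\<close>, and division by \<open>b\<close> more than halves it unless
    \<open>R = 0\<close>.\<close>
  define R where "R = max \<bar>\<xi>\<bar> (of_int \<bar>t\<bar> * real N)"
  have R: "0 \<le> R" "of_int \<bar>t\<bar> * real N \<le> R" "\<xi> \<in> {-R..R}" by (auto simp: R_def)
  obtain x0 where x0: "x0 \<in> {-R..R}" "\<And>y. y \<in> {-R..R} \<Longrightarrow> total_energy x0 \<le> total_energy y"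
  proof -
    have "{-R..R} \<noteq> {}" using R(3) by auto
    moreover have "continuous_on {-R..R} total_energy"
      using isCont_total_energy by (intro continuous_at_imp_continuous_on) auto
    ultimately have "\<exists>x\<in>{-R..R}. \<forall>y\<in>{-R..R}. total_energy x \<le> total_energy y"
      by (rule continuous_attains_inf[OF compact_Icc])
    then show ?thesis using that by blast
  qed
  define m where "m = total_energy x0"
  have m: "m < 1" using x0(2)[OF R(3)] less by (simp add: m_def)
  have child_mem: "child x c \<in> {-R..R}" if "x \<in> {-R..R}" "c \<in> C" for x c
  proof -
    have "\<bar>real_of_int c\<bar> \<le> real N" using that(2) a by auto
    then have "\<bar>real_of_int (t * c)\<bar> \<le> R"
      using mult_left_mono[of "\<bar>real_of_int c\<bar>" "real N" "of_int \<bar>t\<bar>"] R(2) by (simp add: abs_mult)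
    then have "\<bar>x - of_int (t * c)\<bar> \<le> 2 * R" using that(1) by auto
    also have "\<dots> \<le> real b * R" using b_gt R(1) by (intro mult_right_mono) auto
    finally have "\<bar>child x c\<bar> \<le> R" using b_gt by (simp add: child_def abs_divide field_simps)
    then show ?thesis by auto
  qed
  have child_min: "total_energy (child x c) = m"
    if x: "x \<in> {-R..R}" "total_energy x = m" and c: "c \<in> C" "weight x c \<noteq> 0" for x c
  proof -
    \<comment> \<open>The minimum principle: by harmonicity and total weight 1, the weighted mean of
      the excesses over \<open>m\<close> is 0, while no excess is negative on the invariant
      interval.\<close>
    have "(\<Sum>c\<in>C. weight x c * (total_energy (child x c) - m)) = 0"
      using x(2) total_energy_harmonic[of x]
      by (simp add: right_diff_distrib sum_subtractf weight_sum flip: sum_distrib_right)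
    moreover have "0 \<le> weight x c * (total_energy (child x c) - m)" if "c \<in> C" for c
      using x0(2)[OF child_mem[OF x(1) that]] by (simp add: weight_def m_def)
    ultimately have "\<forall>c\<in>C. weight x c * (total_energy (child x c) - m) = 0"
      by (subst (asm) sum_nonneg_eq_0_iff) auto
    then show ?thesis using c by auto
  qed
  have Ints: "x \<in> \<int>" if x: "x \<in> {-R..R}" "total_energy x = m" for x
  proof (rule ccontr)
    assume nonint: "x \<notin> \<int>"
    have frac: "x / real b ^ k \<notin> \<int>" for k
    proof
      assume "x / real b ^ k \<in> \<int>"
      then have "x / real b ^ k * real b ^ k \<in> \<int>" by (intro Ints_mult) auto
      then show False using nonint b_gt by simp
    qed
    have "x / real b ^ k \<in> {-R..R} \<and> total_energy (x / real b ^ k) = m" for k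
    proof (induction k)
      case (Suc k)
      have c: "child (x / real b ^ k) 0 = x / real b ^ Suc k"
        by (simp add: child_def)
      \<comment> \<open>For the digit 0 the mean is evaluated at the current point divided by
        \<open>N\<close>; a zero there would make the current point an integer.\<close>
      have "weight (x / real b ^ k) 0 \<noteq> 0"
        using char_mean_neq_0[of N "x / real b ^ k / real N"] frac[of k] N
        by (simp add: weight_def)
      then show ?case
        using Suc child_mem[of "x / real b ^ k" 0] child_min[of "x / real b ^ k" 0] zero_in_digits
        by (simp add: c)
    qed (use x in simp)
    then have "(\<lambda>k. total_energy (x / real b ^ k)) = (\<lambda>k. m)" by auto
    moreover have "(\<lambda>k. x * inverse (real b) ^ k) \<longlonglongrightarrow> x * 0"
      using b_gt by (intro tendsto_mult tendsto_const LIMSEQ_power_zero) (simp add: inverse_less_1_iff)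
    then have "(\<lambda>k. x / real b ^ k) \<longlonglongrightarrow> 0"
      by (simp add: divide_inverse power_inverse)
    then have "(\<lambda>k. total_energy (x / real b ^ k)) \<longlonglongrightarrow> total_energy 0"
      by (rule isCont_tendsto_compose[OF isCont_total_energy])
    ultimately show False using m total_energy_0 by (simp add: LIMSEQ_const_iff)
  qed
  define E where "E = {x :: int. of_int x \<in> {-R..R} \<and> total_energy (of_int x) = m}"
  have "trap E"
    unfolding trap_def
  proof (intro conjI ballI)
    obtain k where "x0 = of_int k" using Ints[OF x0(1)] by (auto simp: m_def elim: Ints_cases)
    then show "E \<noteq> {}" using x0(1) by (auto simp: E_def m_def)
    show "0 \<notin> E" using total_energy_0 m by (auto simp: E_def)
    fix x assume x: "x \<in> E"
    \<comment> \<open>The weights sum to 1, so some move has positive weight; it leads to another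
      minimiser, which is again an integer.\<close>
    obtain c where c: "c \<in> C" "weight (of_int x) c \<noteq> 0"
      using weight_sum[of "of_int x"] sum.neutral[of C "weight (of_int x)"] by fastforce
    have J: "child (of_int x) c \<in> {-R..R}" using x c by (intro child_mem) (auto simp: E_def)
    have M: "total_energy (child (of_int x) c) = m" using x c by (intro child_min) (auto simp: E_def)
    obtain y where y: "child (of_int x) c = of_int y" using Ints[OF J M] by (auto elim: Ints_cases)
    then have "y \<in> E" using J M by (simp add: E_def)
    have "real_of_int (x - t * c) = real b * of_int y"
      using y b_gt by (simp add: child_def field_simps)
    also have "\<dots> = real_of_int (int b * y)" by simp
    finally have "x - t * c = int b * y" unfolding of_int_eq_iff .
    then have "x = t * c + int b * y" by simp
    then show "\<exists>c\<in>C. \<exists>y\<in>E. x = t * c + int b * y" using c(1) \<open>y \<in> E\<close> by blast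
  qed
  then show False using no_trap by blast
qed

text \<open>Without traps the energies tend to 1, so the residuals of all exponentials tend to 0.
  All exponentials then lie in the closed span, and by density so does the whole space.\<close>

theorem (in digit_spectrum) basis_iff_no_trap:
  "L2_orthonormal_basis \<mu> (\<Union>n. freqs n) (\<lambda>l. expo (of_int (t * l))) \<longleftrightarrow> (\<nexists>E. trap E)"
proof
  assume no_trap: "\<nexists>E. trap E"
  let ?e = "\<lambda>l. expo (of_int (t * l))"
  let ?V = "L2_span_closure \<mu> (\<Union>n. freqs n) ?e"
  have V: "expo \<xi> \<in> ?V" for \<xi>
    unfolding L2_span_closure_def
  proof (intro CollectI conjI allI impI expo_L2)
    fix \<epsilon> :: real assume \<epsilon>: "\<epsilon> > 0"
    have "(\<lambda>n. energy n \<xi>) \<longlonglongrightarrow> 1"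
      using energy_tendsto[of \<xi>] unfolding no_trap_imp_total_energy[OF no_trap] .
    moreover have "1 - \<epsilon>\<^sup>2 < 1" using \<epsilon> by simp
    ultimately have "\<forall>\<^sub>F n in sequentially. 1 - \<epsilon>\<^sup>2 < energy n \<xi>" by (rule order_tendstoD(1))
    then obtain n where n: "1 - \<epsilon>\<^sup>2 < energy n \<xi>" by (auto simp: eventually_sequentially)
    have "(L2_norm \<mu> (\<lambda>x. expo \<xi> x - (\<Sum>l\<in>freqs n. ft (\<xi> - of_int (t * l)) * ?e l x)))\<^sup>2 < \<epsilon>\<^sup>2"
      using projection_residual[OF expo_L2, of \<xi> n] n
      unfolding inner_expo norm_expo_L2 energy_def by linarith
    then have "L2_norm \<mu> (\<lambda>x. expo \<xi> x - (\<Sum>l\<in>freqs n. ft (\<xi> - of_int (t * l)) * ?e l x)) < \<epsilon>"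
      by (rule power2_less_imp_less) (use \<epsilon> in simp)
    then show "\<exists>F c. finite F \<and> F \<subseteq> (\<Union>n. freqs n) \<and>
        L2_norm \<mu> (\<lambda>x. expo \<xi> x - (\<Sum>l\<in>F. c l * ?e l x)) < \<epsilon>"
      by (intro exI[of _ "freqs n"] exI[of _ "\<lambda>l. ft (\<xi> - of_int (t * l))"] conjI finite_freqs UN_upper UNIV_I)
  qed
  obtain R where "emeasure \<mu> (- {-R..R}) = 0" using support by blast
  then have V_all: "f \<in> ?V" if "f \<in> L2_space \<mu>" for f
    by (rule L2_span_closure_expo_dense[OF finite_measure_\<mu> sets_\<mu>]) (rule expo_L2 V that)+
  show "L2_orthonormal_basis \<mu> (\<Union>n. freqs n) ?e"
    unfolding L2_orthonormal_basis_def
  proof (intro conjI ballI)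
    fix l l' assume "l \<in> (\<Union>n. freqs n)" "l' \<in> (\<Union>n. freqs n)"
    then show "L2_inner \<mu> (?e l) (?e l') = (if l = l' then 1 else 0)" by (rule orthonormal)
  next
    fix f assume "f \<in> L2_space \<mu>"
    from V_all[OF this] show "\<forall>\<epsilon>>0. \<exists>F c. finite F \<and> F \<subseteq> (\<Union>n. freqs n) \<and>
        L2_norm \<mu> (\<lambda>x. f x - (\<Sum>l\<in>F. c l * ?e l x)) < \<epsilon>"
      unfolding L2_span_closure_def mem_Collect_eq by (rule conjunct2)
  qed (rule expo_L2)
qed (rule notI, elim exE, use trap_imp_not_basis in blast)

section \<open>From bases indexed by digit expansions to spectral pairs\<close>

text \<open>This passes between the set \<open>t * \<Lambda>\<close> as index set, as in
  \<open>spectral_pair\<close>, and the integer expansions. Injectivity matters, as distinct indices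
  must stay distinct in the orthonormality condition.\<close>

lemma L2_orthonormal_basis_reindex:
  assumes g: "inj_on g J"
  shows "L2_orthonormal_basis M (g ` J) e \<longleftrightarrow> L2_orthonormal_basis M J (\<lambda>j. e (g j))"
proof -
  have "(\<exists>F c. finite F \<and> F \<subseteq> g ` J \<and> L2_norm M (\<lambda>x. f x - (\<Sum>i\<in>F. c i * e i x)) < \<epsilon>)
    \<longleftrightarrow> (\<exists>F c. finite F \<and> F \<subseteq> J \<and> L2_norm M (\<lambda>x. f x - (\<Sum>j\<in>F. c j * e (g j) x)) < \<epsilon>)" for f \<epsilon>
  proof
    assume "\<exists>F c. finite F \<and> F \<subseteq> g ` J \<and> L2_norm M (\<lambda>x. f x - (\<Sum>i\<in>F. c i * e i x)) < \<epsilon>"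
    then obtain F c where F: "finite F" "F \<subseteq> g ` J" "L2_norm M (\<lambda>x. f x - (\<Sum>i\<in>F. c i * e i x)) < \<epsilon>"
      by blast
    obtain G where G: "G \<subseteq> J" "finite G" "F = g ` G"
      using finite_subset_image[OF F(1,2)] by blast
    have "inj_on g G" using g G(1) by (rule inj_on_subset)
    then show "\<exists>F c. finite F \<and> F \<subseteq> J \<and> L2_norm M (\<lambda>x. f x - (\<Sum>j\<in>F. c j * e (g j) x)) < \<epsilon>"
      using F(3) G by (intro exI[of _ G] exI[of _ "\<lambda>j. c (g j)"]) (simp add: sum.reindex)
  next
    assume "\<exists>F c. finite F \<and> F \<subseteq> J \<and> L2_norm M (\<lambda>x. f x - (\<Sum>j\<in>F. c j * e (g j) x)) < \<epsilon>"
    then obtain F c where F: "finite F" "F \<subseteq> J" "L2_norm M (\<lambda>x. f x - (\<Sum>j\<in>F. c j * e (g j) x)) < \<epsilon>"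
      by blast
    have inj: "inj_on g F" using g F(2) by (rule inj_on_subset)
    have "(\<Sum>i\<in>g ` F. c (inv_into F g i) * e i x) = (\<Sum>j\<in>F. c j * e (g j) x)" for x
      by (simp add: sum.reindex[OF inj] inv_into_f_f[OF inj])
    then show "\<exists>F c. finite F \<and> F \<subseteq> g ` J \<and> L2_norm M (\<lambda>x. f x - (\<Sum>i\<in>F. c i * e i x)) < \<epsilon>"
      using F by (intro exI[of _ "g ` F"] exI[of _ "\<lambda>i. c (inv_into F g i)"]) auto
  qed
  then show ?thesis
    unfolding L2_orthonormal_basis_def using g by (auto simp: inj_on_eq_iff)
qed

lemma (in digit_spectrum) Lambda_set_eq_freqs:
  "Lambda_set (real b) (of_int ` C) = of_int ` (\<Union>n. freqs n)"
proof -
  \<comment> \<open>Highest exponent \<open>n\<close> means \<open>n + 1\<close> digits, whence the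
    shift from \<open>n\<close> to \<open>Suc n\<close>; it disappears in the union because the sets
    increase.\<close>
  have *: "{(\<Sum>k\<le>n. real b ^ k * c k) | c. \<forall>k\<le>n. c k \<in> of_int ` C} = of_int ` freqs (Suc n)" for n
  proof (induction n)
    case 0
    show ?case by (auto simp: image_iff)
  next
    case (Suc n)
    have "{(\<Sum>k\<le>Suc n. real b ^ k * c k) | c. \<forall>k\<le>Suc n. c k \<in> of_int ` C}
      = {x + real b * y | x y. x \<in> of_int ` C \<and>
          y \<in> {(\<Sum>k\<le>n. real b ^ k * c k) | c. \<forall>k\<le>n. c k \<in> of_int ` C}}" (is "?L = ?R")
    proof (intro equalityI subsetI)
      fix z assume "z \<in> ?L"
      then obtain c where c: "z = (\<Sum>k\<le>Suc n. real b ^ k * c k)" "\<forall>k\<le>Suc n. c k \<in> of_int ` C" by blast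
      have "z = c 0 + real b * (\<Sum>k\<le>n. real b ^ k * c (Suc k))"
        unfolding c(1) sum.atMost_Suc_shift by (simp add: sum_distrib_left mult.assoc)
      moreover have "\<forall>k\<le>n. c (Suc k) \<in> of_int ` C" "c 0 \<in> of_int ` C"
        using c(2) Suc_le_mono le0 by (blast, blast)
      ultimately show "z \<in> ?R"
        by (intro CollectI exI[of _ "c 0"] exI[of _ "\<Sum>k\<le>n. real b ^ k * c (Suc k)"] conjI
            exI[of _ "\<lambda>k. c (Suc k)"] refl)
    next
      fix z assume "z \<in> ?R"
      then obtain x c where c: "z = x + real b * (\<Sum>k\<le>n. real b ^ k * c k)"
        "x \<in> of_int ` C" "\<forall>k\<le>n. c k \<in> of_int ` C" by blast
      \<comment> \<open>\<open>case_nat x c\<close> is the digit sequence \<open>c\<close> with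
        \<open>x\<close> put in front as the lowest digit.\<close>
      have "z = (\<Sum>k\<le>Suc n. real b ^ k * case_nat x c k)"
        unfolding c(1) sum.atMost_Suc_shift by (simp add: sum_distrib_left mult.assoc)
      moreover have "\<forall>k\<le>Suc n. case_nat x c k \<in> of_int ` C"
        using c(2,3) by (simp only: split: nat.split) simp
      ultimately show "z \<in> ?L" by (intro CollectI exI[of _ "case_nat x c"] conjI)
    qed
    also have "\<dots> = of_int ` freqs (Suc (Suc n))"
      unfolding Suc.IH freqs.simps(2)[of "Suc n"]
    proof (intro equalityI subsetI)
      fix z assume "z \<in> {x + real b * y | x y. x \<in> of_int ` C \<and> y \<in> of_int ` freqs (Suc n)}"
      then obtain c l where "c \<in> C" "l \<in> freqs (Suc n)" "z = of_int c + real b * of_int l" by blast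
      then show "z \<in> of_int ` (\<lambda>(c, l). c + int b * l) ` (C \<times> freqs (Suc n))"
        by (intro image_eqI[of _ _ "c + int b * l"] image_eqI[of _ _ "(c, l)"]) simp_all
    next
      fix z :: real assume "z \<in> of_int ` (\<lambda>(c, l). c + int b * l) ` (C \<times> freqs (Suc n))"
      then obtain p where p: "p \<in> C \<times> freqs (Suc n)" "z = of_int (case p of (c, l) \<Rightarrow> c + int b * l)"
        by blast
      obtain c l where "p = (c, l)" by (cases p)
      with p have "c \<in> C" "l \<in> freqs (Suc n)" "z = of_int (c + int b * l)"
        by (simp_all del: freqs.simps)
      moreover from this have "z = of_int c + real b * of_int l" by simp
      ultimately show "z \<in> {x + real b * y | x y. x \<in> of_int ` C \<and> y \<in> of_int ` freqs (Suc n)}"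
        by blast
    qed
    finally show ?case .
  qed
  have "Lambda_set (real b) (of_int ` C)
      = (\<Union>n. {(\<Sum>k\<le>n. real b ^ k * c k) | c. \<forall>k\<le>n. c k \<in> of_int ` C})"
    by (auto simp: Lambda_set_def)
  also have "\<dots> = of_int ` (\<Union>n. freqs (Suc n))"
    unfolding * by (simp only: image_UN)
  also have "(\<Union>n. freqs (Suc n)) = (\<Union>n. freqs n)"
    using freqs_Suc_mono by blast
  finally show ?thesis .
qed

text \<open>The other requirements on a spectral pair hold automatically here, so completeness
  reduces to the basis property.\<close>

theorem (in digit_spectrum) complete_iff_no_trap:
  "complete_number \<mu> (Lambda_set (real b) (of_int ` C)) (of_int t) \<longleftrightarrow> (\<nexists>E. trap E)"
proof -
  obtain R where R: "emeasure \<mu> (- {-R..R}) = 0" using support by auto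
  have inj: "inj_on (\<lambda>l. real_of_int (t * l)) (\<Union>n. freqs n)"
    using t(1) by (auto simp: inj_on_def)
  have eq: "(\<lambda>l. of_int t * l) ` Lambda_set (real b) (of_int ` C)
      = (\<lambda>l. of_int (t * l)) ` (\<Union>n. freqs n)"
    unfolding Lambda_set_eq_freqs by (simp add: image_image)
  have e: "(\<lambda>l x. exp (- 2 * complex_of_real pi * \<i> * complex_of_real (l * x))) = expo"
    by (simp add: expo_def fun_eq_iff)
  have "complete_number \<mu> (Lambda_set (real b) (of_int ` C)) (of_int t)
      \<longleftrightarrow> L2_orthonormal_basis \<mu> (\<Union>n. freqs n) (\<lambda>l. expo (of_int (t * l)))"
    unfolding complete_number_def spectral_pair_def eq e L2_orthonormal_basis_reindex[OF inj]
    using prob_space_\<mu> sets_\<mu> R compact_Icc[of "-R" R]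
      countable_UN[OF countableI_type countable_finite[OF finite_freqs], THEN countable_image]
    by blast
  then show ?thesis unfolding basis_iff_no_trap .
qed

text \<open>Every element of a trap for \<open>g * s\<close> is divisible by \<open>g\<close>, because \<open>g\<close> divides \<open>b\<close>.\<close>

lemma (in digit_spectrum) trap_rescale:
  assumes s: "digit_spectrum N q b a s \<mu>" and g: "g dvd int b" "t = g * s"
  shows "(\<exists>E. trap E) \<longleftrightarrow> (\<exists>E. digit_spectrum.trap N b a s E)"
proof
  interpret S: digit_spectrum N q b a s \<mu> by fact
  have "g \<noteq> 0" using t(1) g(2) by auto
  {
    assume "\<exists>E. trap E"
    then obtain E where E: "trap E" ..
    then have E0: "E \<noteq> {}" "0 \<notin> E"
      and step: "\<And>x. x \<in> E \<Longrightarrow> \<exists>c\<in>C. \<exists>y\<in>E. x = t * c + int b * y"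
      unfolding trap_def by blast+
    have dvd: "g dvd x" if "x \<in> E" for x
    proof -
      obtain c y where "x = t * c + int b * y"
        using step[OF \<open>x \<in> E\<close>] by blast
      then show ?thesis using g by (simp only: dvd_add dvd_mult2 dvd_triv_left)
    qed
    \<comment> \<open>Dividing a trap by \<open>g\<close> loses no element, and the factor
      \<open>g\<close> cancels from the digit equation.\<close>
    have "S.trap {y. g * y \<in> E}"
      unfolding S.trap_def
    proof (intro conjI ballI)
      obtain x where "x \<in> E" using E0(1) by blast
      moreover from dvd[OF this] obtain y where "x = g * y" ..
      ultimately show "{y. g * y \<in> E} \<noteq> {}" by blast
      show "0 \<notin> {y. g * y \<in> E}" using E0(2) by simp
      fix y assume "y \<in> {y. g * y \<in> E}"
      then obtain c z where cz: "c \<in> C" "z \<in> E" "g * y = t * c + int b * z"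
        using step[of "g * y"] by blast
      from dvd[OF cz(2)] obtain w where w: "z = g * w" ..
      have "g * y = g * (s * c + int b * w)"
        unfolding cz(3) w g(2) by (simp add: distrib_left mult_ac)
      then have "y = s * c + int b * w" using \<open>g \<noteq> 0\<close> unfolding mult_cancel_left by blast
      then show "\<exists>c\<in>C. \<exists>w\<in>{y. g * y \<in> E}. y = s * c + int b * w"
        using cz(1,2) unfolding w by blast
    qed
    then show "\<exists>E. S.trap E" ..
  }
  assume "\<exists>E. S.trap E"
  then obtain E where E: "S.trap E" ..
  have "trap ((*) g ` E)"
    unfolding trap_def
  proof (intro conjI ballI)
    have E0: "E \<noteq> {}" "0 \<notin> E" using E unfolding S.trap_def by blast+
    show "(*) g ` E \<noteq> {}" using E0(1) by simp
    show "0 \<notin> (*) g ` E" using E0(2) \<open>g \<noteq> 0\<close> by auto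
    fix x assume "x \<in> (*) g ` E"
    then obtain y where y: "y \<in> E" "x = g * y" by auto
    from y(1) obtain c z where "c \<in> C" "z \<in> E" "y = s * c + int b * z"
      using E unfolding S.trap_def by blast
    moreover from this have "x = t * c + int b * (g * z)"
      unfolding y(2) g(2) by (simp add: distrib_left mult_ac)
    ultimately show "\<exists>c\<in>C. \<exists>z\<in>(*) g ` E. x = t * c + int b * z" by blast
  qed
  then show "\<exists>E. trap E" ..
qed

text \<open>The half-open interval contains exactly \<open>N\<close> integers, the least being the
  negative of \<open>(N - 1) div 2\<close> for either parity of \<open>N\<close>. Hence it has the
  form required by the locale.\<close>

lemma balanced_digits:
  assumes "N > 0"
  shows "{- (real N / 2)<..real N / 2} \<inter> \<int>
    = of_int ` {- int ((N - 1) div 2)..<- int ((N - 1) div 2) + int N}"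
proof -
  have "of_int c \<in> {- (real N / 2)<..real N / 2}
    \<longleftrightarrow> c \<in> {- int ((N - 1) div 2)..<- int ((N - 1) div 2) + int N}" for c :: int
  proof -
    have "of_int c \<in> {- (real N / 2)<..real N / 2}
        \<longleftrightarrow> real_of_int (- int N) < of_int (2 * c) \<and> real_of_int (2 * c) \<le> of_int (int N)"
      by auto
    also have "\<dots> \<longleftrightarrow> - int N < 2 * c \<and> 2 * c \<le> int N"
      unfolding of_int_less_iff of_int_le_iff ..
    also have "\<dots> \<longleftrightarrow> c \<in> {- int ((N - 1) div 2)..<- int ((N - 1) div 2) + int N}"
      unfolding atLeastLessThan_iff using assms by presburger
    finally show ?thesis .
  qed
  then show ?thesis unfolding Ints_def by blast
qed

theorem proposition1p5:
  fixes N q b t :: nat and D C :: "real set"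
  assumes "N \<ge> 2" and "q \<ge> 2" and "b = q * N"
    and "D = real ` {0..<N}"
    and "C = {- (real N / 2)<..real N / 2} \<inter> \<int>"
    and "t > 0" and "gcd t N = 1"
  shows "complete_number (self_similar_measure (real b) ((\<lambda>d. real q * d) ` D))
           (Lambda_set (real b) C) (real t)
     \<longleftrightarrow> complete_number (self_similar_measure (real b) ((\<lambda>d. real q * d) ` D))
           (Lambda_set (real b) C) (real t / real (gcd t b))"
proof -
  define a where "a = - int ((N - 1) div 2)"
  define g where "g = gcd t b"
  \<comment> \<open>The number \<open>s\<close> is \<open>t / gcd t b\<close>, so both sides of the
    claim concern integer multipliers.\<close>
  obtain s where s: "t = g * s" unfolding g_def using gcd_dvd1[of t b] by blast
  have g: "g > 0" "g dvd b" using \<open>t > 0\<close> by (auto simp: g_def)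
  define \<mu> where "\<mu> = self_similar_measure (real b) ((\<lambda>d. real q * d) ` D)"
  have "b > 1" using assms(1-3) mult_le_mono[of 2 q 2 N] by simp
  then have \<mu>: "self_similar (real b) ((\<lambda>d. real q * d) ` real ` {0..<N}) \<mu>"
    "\<exists>R. emeasure \<mu> (- {-R..R}) = 0"
    unfolding \<mu>_def \<open>D = _\<close> using \<open>N \<ge> 2\<close>
    by (auto intro!: self_similar_measure)
  have a: "a \<le> 0" "0 < a + int N" using \<open>N \<ge> 2\<close> by (auto simp: a_def)
  have ds: "digit_spectrum N q b a (int k) \<mu>" if "k > 0" "gcd k N = 1" for k
    using assms(1-3) a \<mu> that
    by unfold_locales (auto simp: coprime_int_iff coprime_iff_gcd_eq_1)
  \<comment> \<open>As a divisor of \<open>t\<close>, the number \<open>s\<close> is coprime to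
    \<open>N\<close> too, so the trap criterion also applies to \<open>s\<close>.\<close>
  have "coprime (g * s) N"
    using \<open>gcd t N = 1\<close> unfolding s coprime_iff_gcd_eq_1 .
  then have "gcd s N = 1" by (simp add: coprime_iff_gcd_eq_1[symmetric])
  then have S: "digit_spectrum N q b a (int s) \<mu>" using \<open>t > 0\<close> s by (intro ds) auto
  interpret S: digit_spectrum N q b a "int s" \<mu> by (rule S)
  interpret T: digit_spectrum N q b a "int t" \<mu> using assms by (intro ds)
  have C: "C = of_int ` {a..<a + int N}"
    using balanced_digits[of N] \<open>N \<ge> 2\<close> \<open>C = _\<close> by (simp add: a_def)
  have "real t / real (gcd t b) = of_int (int s)"
    using g unfolding g_def[symmetric] by (simp add: s)
  moreover have "(\<exists>E. T.trap E) \<longleftrightarrow> (\<exists>E. S.trap E)"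
    using g(2) s by (intro T.trap_rescale[OF S, of "int g"]) auto
  ultimately show ?thesis
    using T.complete_iff_no_trap S.complete_iff_no_trap unfolding C \<mu>_def[symmetric] by simp
qed

end
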